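(* Let $G=(V,E)$ be an undirected graph, let $m:V\to\mathbb{R}_{\ge 0}$ be an initial mass function and let $\phi\in(0,1]$. Suppose that $|m(\cdot)|:=\sum_{v\in V} m(v)\le \operatorname{vol}(G)$ and that $m(v)\le 2d(v)$ for every $v\in V$ at the start. Then the procedure CRD-inner$(G,m(\cdot),\phi)$ (described in the context) terminates in one of the following two cases: 1. (Full CRD step) $m(v)\le d(v)$ for all $v\in V$. 2. There are nodes with excess, and one can find a cut $A\subseteq V$ of conductance $\Phi(A)=O(\phi)$; moreover $d(v)\le m(v)\le 2d(v)$ for all $v\in A$ and $m(v)\le d(v)$ for all $v\in V\setminus A$. The running time is $O(|m(\cdot)|\log(|m(\cdot)|)/\phi)$.
   Context: For $v\in V$, $d(v)$ is the degree and for $S\subseteq V$, $\operatorname{vol}(S)=\sum_{v\in S}d(v)$, $\operatorname{vol}(G)=\operatorname{vol}(V)$. $E(S,\bar S)$ is the set of edges between $S$ and $\bar S=V\setminus S$, and the conductance of a cut is $\Phi(S)=|E(S,\bar S)|/\min(\operatorname{vol}(S),\operatorname{vol}(V\setminus S))$. The $O(\cdot)$ constants are absolute. Procedure CRD-inner$(G,m(\cdot),\phi)$: each undirected edge $\{u,v\}$ is viewed as two arcs $(u,v),(v,u)$; the procedure maintains net mass $m(u,v)=-m(v,u)$ pushed along arcs (initially $0$), and a label $l(v)$ for each node (initially $0$). Set $h=3\log|m(\cdot)|/\phi$ and $C=1/\phi$. The excess of $v$ is $\operatorname{ex}(v)=\max(m(v)-d(v),0)$. A node $v$ is active if $l(v)<h$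 and $\operatorname{ex}(v)>0$. The effective capacity of arc $(v,u)$ is $\hat c(v,u)=\min(l(v),C)$ and its residual capacity is $r_m(v,u)=\hat c(v,u)-m(v,u)$; the arc is eligible iff $l(v)>l(u)$ and $r_m(v,u)>0$. While there is an active node: let $v$ be an active node of lowest label; if there is an eligible arc $(v,u)$, push $\psi=\min(\operatorname{ex}(v),r_m(v,u),2d(u)-m(u))$ units of mass from $v$ to $u$ (i.e. $m(v,u)\mathrel{+}=\psi$, $m(u,v)\mathrel{-}=\psi$, $m(v)\mathrel{-}=\psi$, $m(u)\mathrel{+}=\psi$); otherwise relabel, $l(v)\leftarrow l(v)+1$. The procedure stops when no node is active. (Implementation: the graph is accessed via adjacency lists, each node keeps a pointer to its current incident edge which is advanced when the arc is not eligible and reset upon relabel, and active nodes are kept in a list ordered by label supporting $O(1)$ add/remove/shift.)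
   Formalization: The O(.) bounds are stated for |m| ≥ 2. The running time is O(N|m|log|m|/φ) when all N·m(v) and N/φ are integers (N=1: the stated bound), and O(|m|(log|m|/φ)²) for arbitrary real masses, since tiny pushes break the stated bound. Cut sides have positive volume. *)

theory Defs
  imports Complex_Main "Graph_Theory.Pair_Digraph"
begin

text \<open>
  A finite simple undirected graph is a \<open>pair_graph\<close>: a finite loop-free symmetric digraph whose
  arcs are ordered pairs. An undirected edge \<open>{u, v}\<close> is thus present as the two arcs \<open>(u, v)\<close>
  and \<open>(v, u)\<close>, and the degree of a vertex is its out-degree.
\<close>

definition vol :: "'a pair_pre_digraph \<Rightarrow> 'a set \<Rightarrow> nat" where
  "vol G S = (\<Sum>v\<in>S. out_degree G v)"

text \<open>
  An edge between \<open>S\<close> and its complement has exactly one of its two arcs leaving \<open>S\<close>, so counting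
  these arcs counts the undirected edges.
\<close>

definition boundary :: "'a pair_pre_digraph \<Rightarrow> 'a set \<Rightarrow> ('a \<times> 'a) set" where
  "boundary G S = {(u, v) \<in> parcs G. u \<in> S \<and> v \<in> pverts G - S}"

text \<open>
  Since division by zero yields zero, this is meaningful only if both sides of the cut have
  positive volume.
\<close>

definition conductance :: "'a pair_pre_digraph \<Rightarrow> 'a set \<Rightarrow> real" where
  "conductance G S = real (card (boundary G S)) / real (min (vol G S) (vol G (pverts G - S)))"

definition total_mass :: "'a pair_pre_digraph \<Rightarrow> ('a \<Rightarrow> real) \<Rightarrow> real" where
  "total_mass G m = (\<Sum>v\<in>pverts G. m v)"


section \<open>The procedure CRD-inner\<close>

record 'a crd_state =
  mass :: "'a \<Rightarrow> real"
  flow :: "'a \<Rightarrow> 'a \<Rightarrow> real"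
  lab  :: "'a \<Rightarrow> nat"

definition crd_init :: "('a \<Rightarrow> real) \<Rightarrow> 'a crd_state" where
  "crd_init m = \<lparr>mass = m, flow = (\<lambda>_ _. 0), lab = (\<lambda>_. 0)\<rparr>"

text \<open>
  Below, \<open>h\<close> is the label bound and \<open>C\<close> the capacity bound. Both are fixed when the procedure
  starts, \<open>h\<close> being computed from the initial mass; labels are integers, \<open>h\<close> is a real number.
  For total mass slightly above \<open>1\<close>, \<open>h\<close> can be arbitrarily close to \<open>0\<close> however small \<open>\<phi>\<close> is, and the
  procedure halts after a single relabelling; asymptotic bounds are therefore to be read for total
  mass at least \<open>2\<close>.
\<close>

definition crd_height :: "'a pair_pre_digraph \<Rightarrow> ('a \<Rightarrow> real) \<Rightarrow> real \<Rightarrow> real" where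
  "crd_height G m \<phi> = 3 * ln (total_mass G m) / \<phi>"

definition excess :: "'a pair_pre_digraph \<Rightarrow> 'a crd_state \<Rightarrow> 'a \<Rightarrow> real" where
  "excess G s v = max (mass s v - real (out_degree G v)) 0"

definition active :: "'a pair_pre_digraph \<Rightarrow> real \<Rightarrow> 'a crd_state \<Rightarrow> 'a \<Rightarrow> bool" where
  "active G h s v \<longleftrightarrow> v \<in> pverts G \<and> real (lab s v) < h \<and> excess G s v > 0"

definition lowest_active :: "'a pair_pre_digraph \<Rightarrow> real \<Rightarrow> 'a crd_state \<Rightarrow> 'a \<Rightarrow> bool" where
  "lowest_active G h s v \<longleftrightarrow> active G h s v \<and> (\<forall>w. active G h s w \<longrightarrow> lab s v \<le> lab s w)"

definition residual :: "real \<Rightarrow> 'a crd_state \<Rightarrow> 'a \<Rightarrow> 'a \<Rightarrow> real" where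
  "residual C s v u = min (real (lab s v)) C - flow s v u"

definition eligible :: "'a pair_pre_digraph \<Rightarrow> real \<Rightarrow> 'a crd_state \<Rightarrow> 'a \<Rightarrow> 'a \<Rightarrow> bool" where
  "eligible G C s v u \<longleftrightarrow> (v, u) \<in> parcs G \<and> lab s v > lab s u \<and> residual C s v u > 0"

definition push_amount :: "'a pair_pre_digraph \<Rightarrow> real \<Rightarrow> 'a crd_state \<Rightarrow> 'a \<Rightarrow> 'a \<Rightarrow> real" where
  "push_amount G C s v u =
     min (excess G s v) (min (residual C s v u) (2 * real (out_degree G u) - mass s u))"

definition push :: "'a pair_pre_digraph \<Rightarrow> real \<Rightarrow> 'a crd_state \<Rightarrow> 'a \<Rightarrow> 'a \<Rightarrow> 'a crd_state" where
  "push G C s v u =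
     (let \<psi> = push_amount G C s v u in
      s\<lparr>mass := (mass s)(v := mass s v - \<psi>, u := mass s u + \<psi>),
        flow := (\<lambda>x y. if (x, y) = (v, u) then flow s v u + \<psi>
                       else if (x, y) = (u, v) then flow s u v - \<psi>
                       else flow s x y)\<rparr>)"

definition relabel :: "'a crd_state \<Rightarrow> 'a \<Rightarrow> 'a crd_state" where
  "relabel s v = s\<lparr>lab := (lab s)(v := Suc (lab s v))\<rparr>"

text \<open>
  One iteration of the while loop. Which active node of lowest label and which eligible arc are
  taken is left open; the procedure halts when no node is active.
\<close>

inductive crd_step :: "'a pair_pre_digraph \<Rightarrow> real \<Rightarrow> real \<Rightarrow> 'a crd_state \<Rightarrow> 'a crd_state \<Rightarrow> bool"
  for G h C where
  step_push: "lowest_active G h s v \<Longrightarrow> eligible G C s v u \<Longrightarrow>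
    crd_step G h C s (push G C s v u)"
| step_relabel: "lowest_active G h s v \<Longrightarrow> \<forall>u. \<not> eligible G C s v u \<Longrightarrow>
    crd_step G h C s (relabel s v)"

definition crd_halted :: "'a pair_pre_digraph \<Rightarrow> real \<Rightarrow> 'a crd_state \<Rightarrow> bool" where
  "crd_halted G h s \<longleftrightarrow> (\<forall>v. \<not> active G h s v)"


section \<open>The implementation and its running time\<close>

definition adjacency_lists :: "'a pair_pre_digraph \<Rightarrow> ('a \<Rightarrow> 'a list) \<Rightarrow> bool" where
  "adjacency_lists G adj \<longleftrightarrow>
     (\<forall>v\<in>pverts G. distinct (adj v) \<and> set (adj v) = {u. (v, u) \<in> parcs G})"

text \<open>
  The second component of a state points, for every node \<open>v\<close>, to its current position in \<open>adj v\<close>.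
  The pointer moves on when the current arc is not eligible; when it moves past the last arc, the
  node is relabelled and the pointer is reset. Each transition is an elementary operation of
  constant cost: retrieving an active node of lowest label, and updating the list of active nodes
  (which is ordered by label), take constant time. The order of nodes with equal label is left open.
\<close>

inductive crd_impl_step :: "'a pair_pre_digraph \<Rightarrow> real \<Rightarrow> real \<Rightarrow> ('a \<Rightarrow> 'a list) \<Rightarrow>
    'a crd_state \<times> ('a \<Rightarrow> nat) \<Rightarrow> 'a crd_state \<times> ('a \<Rightarrow> nat) \<Rightarrow> bool"
  for G h C adj where
  impl_push: "lowest_active G h s v \<Longrightarrow> u = adj v ! ptr v \<Longrightarrow> eligible G C s v u \<Longrightarrow>
    crd_impl_step G h C adj (s, ptr) (push G C s v u, ptr)"
| impl_advance: "lowest_active G h s v \<Longrightarrow> \<not> eligible G C s v (adj v ! ptr v) \<Longrightarrow>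
    Suc (ptr v) < length (adj v) \<Longrightarrow>
    crd_impl_step G h C adj (s, ptr) (s, ptr(v := Suc (ptr v)))"
| impl_relabel: "lowest_active G h s v \<Longrightarrow> \<not> eligible G C s v (adj v ! ptr v) \<Longrightarrow>
    \<not> Suc (ptr v) < length (adj v) \<Longrightarrow>
    crd_impl_step G h C adj (s, ptr) (relabel s v, ptr(v := 0))"

definition crd_impl_init :: "('a \<Rightarrow> real) \<Rightarrow> 'a crd_state \<times> ('a \<Rightarrow> nat)" where
  "crd_impl_init m = (crd_init m, \<lambda>_. 0)"

text \<open>
  The running time after \<open>n\<close> elementary operations; the first summand is the cost of setting up the
  list of active nodes.
\<close>

definition crd_time :: "'a pair_pre_digraph \<Rightarrow> real \<Rightarrow> ('a \<Rightarrow> real) \<Rightarrow> nat \<Rightarrow> nat" where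
  "crd_time G h m n = card {v. active G h (crd_init m) v} + n"

text \<open>
  If this holds, all amounts of mass occurring in a run with \<open>C = 1 / \<phi>\<close> are multiples of \<open>1 / N\<close>.
  For \<open>N = 1\<close>, mass comes in whole units and \<open>1 / \<phi>\<close> is an integer. The number of pushes can be
  bounded by \<open>O(|m| log |m| / \<phi>)\<close> only at a given granularity: with arbitrary real masses, pushes can
  be arbitrarily small and there are runs with too many of them.
\<close>

definition granular :: "'a pair_pre_digraph \<Rightarrow> ('a \<Rightarrow> real) \<Rightarrow> real \<Rightarrow> nat \<Rightarrow> bool" where
  "granular G m \<phi> N \<longleftrightarrow>
     N \<ge> 1 \<and> (\<forall>v\<in>pverts G. real N * m v \<in> \<int>) \<and> real N / \<phi> \<in> \<int>"

end

theory Submission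
  imports Defs "HOL-Analysis.Harmonic_Numbers"
begin

text \<open>
  Termination and running time come from potentials. Let \<open>D\<close> be the sum of \<open>d(v) l(v)\<close>; since nodes
  with positive label have mass at least \<open>d(v)\<close>, it is at most \<open>|m|\<close> times the largest label. Every
  push moves mass down by at least one level, so the sum of \<open>m(v) l(v)\<close> drops by at least the amount
  pushed, while a relabelling raises it by at most \<open>2 d(v)\<close>. This bounds the number of pushes when all
  pushes have a minimal size. In general, a push saturates an arc (which then stays ineligible until
  its tail is relabelled), or moves at least one unit of mass, or empties the excess of its source.

  For the cut, suppose that a node with excess remains, necessarily at maximal label, and consider the
  level sets \<open>S\<^sub>i = {v. l(v) \<ge> i}\<close>. Arcs leaving \<open>S\<^sub>i\<close> that drop by two or more levels carry a flow of
  order \<open>min(i, 1/\<phi>)\<close> out of \<open>S\<^sub>i\<close>, so their number is controlled by the volume of the smaller side and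
  by the number of arcs from level \<open>i\<close> to level \<open>i - 1\<close>. If the latter were large for all \<open>i\<close>, volumes
  would grow geometrically, either from the top level down or from the bottom up, beyond \<open>|m|\<close>.
\<close>

section \<open>Invariants\<close>

lemma card_neighbours: "card {u. (v, u) \<in> parcs G} = out_degree (with_proj G) v"
proof -
  have "out_arcs (with_proj G) v = Pair v ` {u. (v, u) \<in> parcs G}"
    by (auto simp: out_arcs_def)
  then show ?thesis
    by (simp add: out_degree_def card_image inj_on_def)
qed

text \<open>The values of \<open>h\<close> and \<open>C\<close> stay open here: invariants and
  potentials use only \<open>0 \<le> C\<close>. The relation to \<open>\<phi>\<close> enters with
  the sparse cut and the final numerical bounds.\<close>

locale crd_inner = pair_graph G for G :: "'a pair_pre_digraph" +
  fixes m :: "'a \<Rightarrow> real" and h C :: real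
  assumes init_nonneg: "v \<in> pverts G \<Longrightarrow> 0 \<le> m v"
    and init_le: "v \<in> pverts G \<Longrightarrow> m v \<le> 2 * real (out_degree G v)"
    and C_nonneg: "0 \<le> C"
begin

abbreviation deg :: "'a \<Rightarrow> real" where
  "deg v \<equiv> real (out_degree G v)"

text \<open>A label strictly below \<open>h\<close> may still be raised by one, so the ceiling of
  \<open>h\<close> is the cap on all labels. \<open>nat\<close> makes it \<open>0\<close> when
  \<open>h\<close> is not positive, where no node is ever active.\<close>

definition hmax :: nat where
  "hmax = nat \<lceil>h\<rceil>"

text \<open>
  The last clause is the point of releasing capacity one unit per relabelling: an arc that drops by
  two or more levels was saturated when its tail was last relabelled.
\<close>

definition valid :: "'a crd_state \<Rightarrow> bool" where
  "valid s \<longleftrightarrow>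
     (\<forall>v\<in>pverts G. 0 \<le> mass s v \<and> mass s v \<le> 2 * deg v \<and> (lab s v > 0 \<longrightarrow> deg v \<le> mass s v)) \<and>
     (\<forall>v. lab s v \<le> hmax) \<and>
     (\<forall>v u. flow s v u = - flow s u v \<and> flow s v u \<le> min (real (lab s v)) C) \<and>
     (\<forall>v u. (v, u) \<notin> parcs G \<longrightarrow> flow s v u = 0) \<and>
     (\<forall>v\<in>pverts G. mass s v + (\<Sum>u\<in>pverts G. flow s v u) = m v) \<and>
     (\<forall>v u. (v, u) \<in> parcs G \<and> lab s u + 2 \<le> lab s v \<longrightarrow> min (real (lab s v) - 1) C \<le> flow s v u)"

lemma valid_init: "valid (crd_init m)"
  using init_nonneg init_le C_nonneg by (auto simp: valid_def crd_init_def)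

lemma active_deg_less: "active G h s v \<Longrightarrow> deg v < mass s v"
  by (auto simp: active_def excess_def max_def split: if_splits)

lemma arc_swap: "(v, u) \<in> parcs G \<Longrightarrow> (u, v) \<in> parcs G"
  using arcs_symmetric by auto

lemma deg_pos: "(v, u) \<in> parcs G \<Longrightarrow> 1 \<le> deg v"
proof -
  assume "(v, u) \<in> parcs G"
  moreover have "finite {u. (v, u) \<in> parcs G}"
    by (rule finite_subset[of _ "pverts G"]) (auto dest: in_arcsD2)
  ultimately have "card {u. (v, u) \<in> parcs G} > 0"
    by (auto simp: card_gt_0_iff)
  then show ?thesis
    by (simp add: card_neighbours)
qed

section \<open>Effect of a push and of a relabelling on the invariants\<close>

definition netted :: "'a \<Rightarrow> 'a \<Rightarrow> real \<Rightarrow> 'a \<Rightarrow> 'a \<Rightarrow> real" where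
  "netted v u a x y = (if x = v \<and> y = u then a else if x = u \<and> y = v then - a else 0)"

text \<open>The choice of a lowest active node is what matters: the target \<open>u\<close> has a
  smaller label, which is below \<open>h\<close>, so it cannot be active and has no excess. Its room
  is therefore at least \<open>deg u\<close>, hence at least \<open>1\<close>. This gives positivity
  of the push and the third alternative of \<open>push_amount_cases\<close>.\<close>

lemma push_facts:
  assumes "valid s" "lowest_active G h s v" "eligible G C s v u"
  defines "\<psi> \<equiv> push_amount G C s v u"
  shows push_amount_pos: "0 < \<psi>" and push_amount_excess: "\<psi> \<le> mass s v - deg v"
    and push_amount_residual: "\<psi> \<le> residual C s v u"
    and push_amount_room: "\<psi> \<le> 2 * deg u - mass s u"
    and push_target_mass: "mass s u \<le> deg u"
    and push_amount_cases:
      "\<psi> = mass s v - deg v \<or> \<psi> = residual C s v u \<or> 1 \<le> \<psi>"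
    and push_verts: "v \<in> pverts G" "u \<in> pverts G" "v \<noteq> u" "(v, u) \<in> parcs G"
    and push_lab: "lab s u < lab s v"
proof -
  show arc: "(v, u) \<in> parcs G" and lab: "lab s u < lab s v"
    using assms by (auto simp: eligible_def)
  show verts: "v \<in> pverts G" "u \<in> pverts G" "v \<noteq> u"
    using arc by (auto dest: in_arcsD1 in_arcsD2 no_loops')
  have act: "active G h s v"
    using assms by (auto simp: lowest_active_def)
  have "\<not> active G h s u"
    using assms(2) lab by (auto simp: lowest_active_def not_le[symmetric])
  moreover have "real (lab s u) < h"
    using act lab by (auto simp: active_def)
  ultimately show u: "mass s u \<le> deg u"
    using verts by (auto simp: active_def excess_def max_def split: if_splits)
  have "1 \<le> deg u"
    using deg_pos[OF arc_swap[OF arc]] .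
  moreover have ex: "excess G s v = mass s v - deg v" "deg v < mass s v"
    using active_deg_less[OF act] by (auto simp: excess_def)
  moreover have "0 < residual C s v u"
    using assms by (auto simp: eligible_def)
  ultimately show "0 < \<psi>" "\<psi> \<le> mass s v - deg v" "\<psi> \<le> residual C s v u"
      "\<psi> \<le> 2 * deg u - mass s u" "\<psi> = mass s v - deg v \<or> \<psi> = residual C s v u \<or> 1 \<le> \<psi>"
    using u unfolding \<psi>_def push_amount_def by (auto simp: min_def)
qed

lemma push_fields:
  assumes "v \<noteq> u"
  shows "mass (push G C s v u) =
      (mass s)(v := mass s v - push_amount G C s v u, u := mass s u + push_amount G C s v u)"
    and "lab (push G C s v u) = lab s"
    and "flow (push G C s v u) x y = flow s x y + netted v u (push_amount G C s v u) x y"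
  using assms by (auto simp: push_def Let_def netted_def)

lemma relabel_fields:
  "mass (relabel s v) = mass s" "flow (relabel s v) = flow s"
  "lab (relabel s v) = (lab s)(v := Suc (lab s v))"
  by (auto simp: relabel_def)

lemma sum_netted:
  assumes "v \<in> pverts G" "u \<in> pverts G" "v \<noteq> u"
  shows "(\<Sum>y\<in>pverts G. netted v u a x y) = (if x = v then a else if x = u then - a else 0)"
proof -
  have "netted v u a x y =
      (if y = u then if x = v then a else 0 else 0) + (if y = v then if x = u then - a else 0 else 0)" for y
    using assms by (auto simp: netted_def)
  then show ?thesis
    using assms by (simp add: sum.distrib pair_finite_verts)
qed

text \<open>Only \<open>(v, u)\<close> gains flow, within its residual, and only the reverse arc
  loses flow. The reverse arc goes uphill, so the lower bounds on arcs dropping two levels survive.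
  The source gives away only excess and so keeps at least its degree.\<close>

lemma valid_push:
  assumes "valid s" "lowest_active G h s v" "eligible G C s v u"
  shows "valid (push G C s v u)"
proof -
  define a where "a = push_amount G C s v u"
  note facts = push_facts[OF assms, folded a_def]
  note fields = push_fields[OF facts(9), where s = s, folded a_def]
  have res: "flow s v u + a \<le> min (real (lab s v)) C"
    using facts(3) by (auto simp: residual_def)
  note V = assms(1)[unfolded valid_def]
  have cap: "flow s x y + netted v u a x y \<le> min (real (lab s x)) C" for x y
  proof (cases "x = v \<and> y = u")
    case True
    then show ?thesis using res by (simp add: netted_def)
  next
    case False
    then have "netted v u a x y \<le> 0"
      using facts(1) by (auto simp: netted_def)
    moreover have "flow s x y \<le> min (real (lab s x)) C"
      using V by blast
    ultimately show ?thesis by linarith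
  qed
  have anti: "flow s x y + netted v u a x y = - (flow s y x + netted v u a y x)" for x y
  proof -
    have "flow s x y = - flow s y x"
      using V by blast
    then show ?thesis
      using facts(9) by (auto simp: netted_def)
  qed
  have drop: "min (real (lab s x) - 1) C \<le> flow s x y + netted v u a x y"
    if "(x, y) \<in> parcs G" "lab s y + 2 \<le> lab s x" for x y
  proof -
    have "0 \<le> netted v u a x y"
      using that facts(1,11) by (auto simp: netted_def)
    moreover have "min (real (lab s x) - 1) C \<le> flow s x y"
      using V that by blast
    ultimately show ?thesis by linarith
  qed
  have arcs: "flow s x y + netted v u a x y = 0" if "(x, y) \<notin> parcs G" for x y
  proof -
    have "flow s x y = 0"
      using V that by blast
    moreover have "netted v u a x y = 0"
      using that facts(10) arc_swap[OF facts(10)] by (auto simp: netted_def)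
    ultimately show ?thesis by simp
  qed
  have total: "mass (push G C s v u) x + (\<Sum>y\<in>pverts G. flow s x y + netted v u a x y) = m x"
    if "x \<in> pverts G" for x
  proof -
    have "mass s x + (\<Sum>y\<in>pverts G. flow s x y) = m x"
      using V that by blast
    then show ?thesis
      using facts(9) by (auto simp: fields sum.distrib sum_netted[OF facts(7-9)])
  qed
  have bounds: "0 \<le> mass (push G C s v u) x \<and> mass (push G C s v u) x \<le> 2 * deg x \<and>
      (lab s x > 0 \<longrightarrow> deg x \<le> mass (push G C s v u) x)" if "x \<in> pverts G" for x
  proof -
    have "0 \<le> mass s x" "mass s x \<le> 2 * deg x" "lab s x > 0 \<longrightarrow> deg x \<le> mass s x"
      using V that by blast+
    then show ?thesis
      using facts(1-4,9) of_nat_0_le_iff[of "out_degree G v"] by (auto simp: fields)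
  qed
  have lab: "lab s x \<le> hmax" for x
    using V by blast
  show ?thesis
    unfolding valid_def fields(2,3)
    by (intro conjI allI ballI impI) (use cap anti drop arcs total bounds lab in blast)+
qed

lemma active_lab_less: "active G h s v \<Longrightarrow> Suc (lab s v) \<le> hmax"
  unfolding active_def hmax_def by linarith

lemma not_eligible_saturated:
  assumes "(v, u) \<in> parcs G" "lab s u < lab s v" "\<not> eligible G C s v u"
  shows "min (real (lab s v)) C \<le> flow s v u"
  using assms by (auto simp: eligible_def residual_def)

text \<open>An arc out of \<open>v\<close> that drops two levels afterwards dropped at least one
  before. Being ineligible, it was saturated for the old label, which is the new label minus one.
  Arcs into \<open>v\<close> only lose height difference, so their bound is inherited.\<close>

lemma valid_relabel:
  assumes "valid s" "lowest_active G h s v" "\<forall>u. \<not> eligible G C s v u"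
  shows "valid (relabel s v)"
proof -
  note V = assms(1)[unfolded valid_def]
  have act: "active G h s v"
    using assms by (auto simp: lowest_active_def)
  have cap: "flow s x y \<le> min (real (lab (relabel s v) x)) C" for x y
  proof -
    have "flow s x y \<le> min (real (lab s x)) C"
      using V by blast
    then show ?thesis by (auto simp: relabel_fields)
  qed
  have drop: "min (real (lab (relabel s v) x) - 1) C \<le> flow s x y"
    if arc: "(x, y) \<in> parcs G" and lab: "lab (relabel s v) y + 2 \<le> lab (relabel s v) x" for x y
  proof (cases "x = v")
    case True
    then have "lab s y < lab s v"
      using lab no_loops'[OF arc] by (auto simp: relabel_fields)
    then show ?thesis
      using not_eligible_saturated[of v y s] assms(3) arc True by (auto simp: relabel_fields)
  next
    case False
    then have "lab s y + 2 \<le> lab s x"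
      using lab by (auto simp: relabel_fields split: if_splits)
    then have "min (real (lab s x) - 1) C \<le> flow s x y"
      using V arc by blast
    then show ?thesis
      using False by (auto simp: relabel_fields)
  qed
  have lab: "lab (relabel s v) x \<le> hmax" for x
  proof -
    have "lab s x \<le> hmax"
      using V by blast
    then show ?thesis
      using active_lab_less[OF act] by (auto simp: relabel_fields)
  qed
  have sat: "lab (relabel s v) x > 0 \<longrightarrow> deg x \<le> mass s x" if "x \<in> pverts G" for x
  proof -
    have "lab s x > 0 \<longrightarrow> deg x \<le> mass s x"
      using V that by blast
    then show ?thesis
      using active_deg_less[OF act] by (auto simp: relabel_fields)
  qed
  show ?thesis
    unfolding valid_def relabel_fields(1,2)
    by (intro conjI allI ballI impI) (use V cap drop lab sat in blast)+
qed

lemma valid_step: "crd_step G h C s s' \<Longrightarrow> valid s \<Longrightarrow> valid s'"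
  by (induction rule: crd_step.induct) (auto intro: valid_push valid_relabel)

lemma valid_steps: "(crd_step G h C)\<^sup>*\<^sup>* s s' \<Longrightarrow> valid s \<Longrightarrow> valid s'"
  by (induction rule: rtranclp_induct) (auto intro: valid_step)

section \<open>Persistence of saturated nodes and of ineligible arcs\<close>

lemma saturated_push:
  assumes "valid s" "lowest_active G h s v" "eligible G C s v u" "deg w \<le> mass s w"
  shows "deg w \<le> mass (push G C s v u) w"
  using push_facts[OF assms(1-3)] assms(4) by (auto simp: push_fields)

text \<open>Eligible arcs go downhill, and the only arc gaining residual capacity,
  \<open>(u, v)\<close>, goes uphill. Hence a push creates no eligible arc.\<close>

lemma eligible_push:
  assumes "valid s" "lowest_active G h s v" "eligible G C s v u" "eligible G C (push G C s v u) x y"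
  shows "eligible G C s x y"
proof -
  note facts = push_facts[OF assms(1-3)]
  have "lab s y < lab s x"
    using assms(4) facts by (auto simp: eligible_def push_fields)
  then have "0 \<le> netted v u (push_amount G C s v u) x y"
    using facts by (auto simp: netted_def)
  then show ?thesis
    using assms(4) facts by (auto simp: eligible_def residual_def push_fields)
qed

text \<open>Raising \<open>v\<close> leaves the capacity of arcs with another tail unchanged and can
  only spoil their descent into \<open>v\<close>. New eligible arcs thus all start at
  \<open>v\<close>.\<close>

lemma eligible_relabel:
  assumes "eligible G C (relabel s v) x y" "x \<noteq> v"
  shows "eligible G C s x y"
  using assms by (auto simp: eligible_def residual_def relabel_fields split: if_splits)

end

section \<open>Potentials and termination\<close>

lemma sum_change_two:
  fixes f g :: "'b \<Rightarrow> real"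
  assumes "finite A" "v \<in> A" "u \<in> A" "v \<noteq> u" "\<And>x. x \<in> A \<Longrightarrow> x \<noteq> v \<Longrightarrow> x \<noteq> u \<Longrightarrow> g x = f x"
  shows "sum g A = sum f A + (g v - f v) + (g u - f u)"
proof -
  have "(\<Sum>x\<in>A. g x - f x) = (\<Sum>x\<in>{v, u}. g x - f x)"
    using assms by (intro sum.mono_neutral_right) auto
  then show ?thesis
    using assms(4) by (simp add: sum_subtractf)
qed

lemma sum_change_one:
  fixes f g :: "'b \<Rightarrow> real"
  assumes "finite A" "v \<in> A" "\<And>x. x \<in> A \<Longrightarrow> x \<noteq> v \<Longrightarrow> g x = f x"
  shows "sum g A = sum f A + (g v - f v)"
proof -
  have "(\<Sum>x\<in>A. g x - f x) = (\<Sum>x\<in>{v}. g x - f x)"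
    using assms by (intro sum.mono_neutral_right) auto
  then show ?thesis
    by (simp add: sum_subtractf)
qed

lemma sum_antisym_zero:
  fixes f :: "'b \<Rightarrow> 'b \<Rightarrow> real"
  assumes "\<And>x y. f x y = - f y x"
  shows "(\<Sum>x\<in>A. \<Sum>y\<in>A. f x y) = 0"
proof -
  have "(\<Sum>x\<in>A. \<Sum>y\<in>A. f x y) = (\<Sum>x\<in>A. \<Sum>y\<in>A. f y x)"
    by (rule sum.swap)
  also have "\<dots> = (\<Sum>x\<in>A. \<Sum>y\<in>A. - f x y)"
    by (intro sum.cong refl assms)
  also have "\<dots> = - (\<Sum>x\<in>A. \<Sum>y\<in>A. f x y)"
    by (simp add: sum_negf)
  finally show ?thesis
    by simp
qed

context crd_inner
begin

definition eligible_arcs :: "'a crd_state \<Rightarrow> ('a \<times> 'a) set" where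
  "eligible_arcs s = {(x, y). eligible G C s x y}"

definition mass_height :: "'a crd_state \<Rightarrow> real" where
  "mass_height s = (\<Sum>v\<in>pverts G. mass s v * real (lab s v))"

definition excess_height :: "'a crd_state \<Rightarrow> real" where
  "excess_height s = (\<Sum>v\<in>pverts G. if deg v < mass s v then real (lab s v) else 0)"

text \<open>The budget of the amortised analysis: pushes leave it unchanged, a relabelling of
  \<open>v\<close> adds \<open>deg v\<close>, and it stays bounded on valid states.\<close>

definition degree_height :: "'a crd_state \<Rightarrow> real" where
  "degree_height s = (\<Sum>v\<in>pverts G. deg v * real (lab s v))"

text \<open>
  A push either saturates an arc, or fills its target with at least one unit of mass, or removes all
  excess of its source; these are paid for by the first, second and third summand respectively. A
  push of the first two kinds may create excess at height up to \<open>hmax\<close>, whence the weights.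
\<close>

definition potential :: "'a crd_state \<Rightarrow> real" where
  "potential s = (real hmax + 1) * (real (card (eligible_arcs s)) + mass_height s) + excess_height s"

lemma finite_eligible_arcs: "finite (eligible_arcs s)"
  by (rule finite_subset[OF _ pair_finite_arcs]) (auto simp: eligible_arcs_def eligible_def)

lemma validD:
  assumes "valid s"
  shows valid_mass_nonneg: "v \<in> pverts G \<Longrightarrow> 0 \<le> mass s v"
    and valid_mass_le: "v \<in> pverts G \<Longrightarrow> mass s v \<le> 2 * deg v"
    and valid_saturated: "v \<in> pverts G \<Longrightarrow> 0 < lab s v \<Longrightarrow> deg v \<le> mass s v"
    and valid_lab_le: "lab s v \<le> hmax"
    and valid_antisym: "flow s v u = - flow s u v"
    and valid_flow_le: "flow s v u \<le> C"
    and valid_flow_arc: "(v, u) \<notin> parcs G \<Longrightarrow> flow s v u = 0"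
    and valid_balance: "v \<in> pverts G \<Longrightarrow> mass s v + (\<Sum>u\<in>pverts G. flow s v u) = m v"
    and valid_drop: "(v, u) \<in> parcs G \<Longrightarrow> lab s u + 2 \<le> lab s v \<Longrightarrow>
      min (real (lab s v) - 1) C \<le> flow s v u"
proof -
  have le: "flow s v u \<le> min (real (lab s v)) C" and anti: "flow s v u = - flow s u v"
    using assms unfolding valid_def by blast+
  from anti show "flow s v u = - flow s u v" .
  from le show "flow s v u \<le> C"
    by auto
qed (use assms in \<open>unfold valid_def, blast\<close>)+

lemma potential_nonneg:
  assumes "valid s" shows "0 \<le> potential s"
  unfolding potential_def mass_height_def excess_height_def
  using valid_mass_nonneg[OF assms] by (intro add_nonneg_nonneg mult_nonneg_nonneg sum_nonneg) auto

lemma mass_height_nonneg: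
  assumes "valid s" shows "0 \<le> mass_height s"
  unfolding mass_height_def
  using valid_mass_nonneg[OF assms] by (intro sum_nonneg mult_nonneg_nonneg) auto

context
  fixes s v u \<psi>
  assumes push: "valid s" "lowest_active G h s v" "eligible G C s v u"
  defines "\<psi> \<equiv> push_amount G C s v u"
begin

lemma degree_height_push: "degree_height (push G C s v u) = degree_height s"
  using push_verts(3)[OF push] by (simp add: degree_height_def push_fields)

lemma mass_height_push: "mass_height (push G C s v u) \<le> mass_height s - \<psi>"
proof -
  note facts = push_facts[OF push, folded \<psi>_def]
  note fields = push_fields[OF facts(9), where s = s, folded \<psi>_def]
  have "mass_height (push G C s v u) = mass_height s - \<psi> * real (lab s v) + \<psi> * real (lab s u)"
    unfolding mass_height_def
    by (subst sum_change_two[where v = v and u = u and f = "\<lambda>x. mass s x * real (lab s x)"])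
      (use facts(7-9) in \<open>auto simp: fields pair_finite_verts algebra_simps\<close>)
  moreover have "\<psi> * (real (lab s u) + 1) \<le> \<psi> * real (lab s v)"
    using facts(1,11) by (intro mult_left_mono) auto
  ultimately show ?thesis
    by (simp add: algebra_simps)
qed

lemma eligible_arcs_push: "card (eligible_arcs (push G C s v u)) \<le> card (eligible_arcs s)"
  using eligible_push[OF push]
  by (intro card_mono finite_eligible_arcs) (auto simp: eligible_arcs_def)

lemma eligible_arcs_push_saturating:
  assumes "\<psi> = residual C s v u"
  shows "card (eligible_arcs (push G C s v u)) < card (eligible_arcs s)"
proof (intro psubset_card_mono finite_eligible_arcs psubsetI)
  show "eligible_arcs (push G C s v u) \<subseteq> eligible_arcs s"
    using eligible_push[OF push] by (auto simp: eligible_arcs_def)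
  note fields = push_fields[OF push_verts(3)[OF push], where s = s, folded \<psi>_def]
  have "residual C (push G C s v u) v u = 0"
    using assms by (simp add: residual_def fields netted_def)
  then have "(v, u) \<notin> eligible_arcs (push G C s v u)"
    by (auto simp: eligible_arcs_def eligible_def)
  moreover have "(v, u) \<in> eligible_arcs s"
    using push(3) by (simp add: eligible_arcs_def)
  ultimately show "eligible_arcs (push G C s v u) \<noteq> eligible_arcs s"
    by blast
qed

text \<open>The target had no excess, so it enters the sum with at most its own label. The source
  leaves the sum exactly when all of its excess is pushed.\<close>

lemma excess_height_push:
  "excess_height (push G C s v u) \<le> excess_height s + real (lab s u) -
     (if \<psi> = mass s v - deg v then real (lab s v) else 0)"
proof -
  note facts = push_facts[OF push, folded \<psi>_def]
  note fields = push_fields[OF facts(9), where s = s, folded \<psi>_def]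
  have "deg v < mass s v"
    using push(2) active_deg_less by (auto simp: lowest_active_def)
  then show ?thesis
    unfolding excess_height_def
    by (subst sum_change_two[where v = v and u = u and
          f = "\<lambda>x. if deg x < mass s x then real (lab s x) else 0"])
      (use facts(5,7-9) in \<open>auto simp: fields pair_finite_verts\<close>)
qed

lemma potential_push: "potential (push G C s v u) + 1 \<le> potential s"
proof -
  note facts = push_facts[OF push, folded \<psi>_def]
  let ?s' = "push G C s v u"
  let ?F = "\<lambda>s. real (card (eligible_arcs s)) + mass_height s"
  have lab: "real (lab s u) \<le> real hmax" "real (lab s u) + 1 \<le> real (lab s v)"
    using valid_lab_le[OF push(1)] facts(11) by auto
  have F: "?F ?s' \<le> ?F s"
    using mass_height_push eligible_arcs_push facts(1) by linarith
  show ?thesis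
  proof (cases "\<psi> = mass s v - deg v")
    case True
    have "(real hmax + 1) * ?F ?s' \<le> (real hmax + 1) * ?F s"
      using F by (intro mult_left_mono) auto
    \<comment> \<open>The label of \<open>v\<close> leaves the sum and at most the strictly smaller
      label of \<open>u\<close> enters.\<close>
    moreover have "excess_height ?s' + 1 \<le> excess_height s"
      using excess_height_push True lab by simp
    ultimately show ?thesis
      unfolding potential_def by linarith
  next
    case False
    then have "\<psi> = residual C s v u \<or> 1 \<le> \<psi>"
      using facts(6) by blast
    then have "?F ?s' + 1 \<le> ?F s"
      using mass_height_push eligible_arcs_push eligible_arcs_push_saturating facts(1) by fastforce
    \<comment> \<open>The weight turns a unit drop into \<open>hmax + 1\<close>: up to
      \<open>hmax\<close> pays for new excess at \<open>u\<close>, and one unit remains.\<close>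
    then have "(real hmax + 1) * (?F ?s' + 1) \<le> (real hmax + 1) * ?F s"
      by (intro mult_left_mono) auto
    then show ?thesis
      using excess_height_push False lab by (simp add: potential_def distrib_left)
  qed
qed

end

context
  fixes s v
  assumes relabel: "valid s" "lowest_active G h s v" "\<forall>u. \<not> eligible G C s v u"
begin

lemma relabel_active: "v \<in> pverts G" "deg v < mass s v" "1 \<le> deg v"
proof -
  show v: "v \<in> pverts G" "deg v < mass s v"
    using relabel(2) active_deg_less by (auto simp: lowest_active_def active_def)
  then have "0 < deg v"
    using valid_mass_le[OF relabel(1), of v] by linarith
  then show "1 \<le> deg v"
    by simp
qed

lemma degree_height_relabel: "degree_height (relabel s v) = degree_height s + deg v"
  unfolding degree_height_def
  by (subst sum_change_one[where v = v and f = "\<lambda>x. deg x * real (lab s x)"])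
    (use relabel_active in \<open>auto simp: relabel_fields pair_finite_verts algebra_simps\<close>)

lemma mass_height_relabel: "mass_height (relabel s v) \<le> mass_height s + 2 * deg v"
  unfolding mass_height_def
  by (subst sum_change_one[where v = v and f = "\<lambda>x. mass s x * real (lab s x)"])
    (use relabel_active valid_mass_le[OF relabel(1), of v] in
      \<open>auto simp: relabel_fields pair_finite_verts algebra_simps\<close>)

lemma excess_height_relabel: "excess_height (relabel s v) \<le> excess_height s + 1"
  unfolding excess_height_def
  by (subst sum_change_one[where v = v and f = "\<lambda>x. if deg x < mass s x then real (lab s x) else 0"])
    (use relabel_active in \<open>auto simp: relabel_fields pair_finite_verts\<close>)

lemma eligible_arcs_relabel:
  "real (card (eligible_arcs (relabel s v))) \<le> real (card (eligible_arcs s)) + deg v"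
proof -
  let ?new = "Pair v ` {u. (v, u) \<in> parcs G}"
  have fin: "finite ?new"
    by (rule finite_subset[OF _ pair_finite_arcs]) auto
  have "eligible_arcs (relabel s v) \<subseteq> eligible_arcs s \<union> ?new"
  proof (rule subrelI)
    fix x y
    assume "(x, y) \<in> eligible_arcs (relabel s v)"
    then have el: "eligible G C (relabel s v) x y"
      by (simp add: eligible_arcs_def)
    then have "x = v \<Longrightarrow> (x, y) \<in> ?new"
      by (auto simp: eligible_def)
    then show "(x, y) \<in> eligible_arcs s \<union> ?new"
      using eligible_relabel[OF el] by (auto simp: eligible_arcs_def)
  qed
  then have "card (eligible_arcs (relabel s v)) \<le> card (eligible_arcs s) + card ?new"
    using fin finite_eligible_arcs[of s]
    by (meson card_Un_le card_mono finite_UnI order_trans)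
  moreover have "card ?new = out_degree G v"
    by (simp add: card_image inj_on_def card_neighbours)
  ultimately show ?thesis
    by simp
qed

text \<open>The factor \<open>3\<close> is one \<open>deg v\<close> for newly eligible arcs plus two
  for the mass raised by one level; the final \<open>1\<close> is the growth of
  \<open>excess_height\<close>.\<close>

lemma potential_relabel:
  "potential (relabel s v) \<le> potential s + 3 * (real hmax + 1) * deg v + 1"
proof -
  let ?F = "\<lambda>s. real (card (eligible_arcs s)) + mass_height s"
  have "(real hmax + 1) * ?F (relabel s v) \<le> (real hmax + 1) * (?F s + 3 * deg v)"
    using mass_height_relabel eligible_arcs_relabel by (intro mult_left_mono) auto
  then show ?thesis
    using excess_height_relabel by (simp add: potential_def algebra_simps)
qed

end

lemma init_heights [simp]:
  "mass_height (crd_init m) = 0" "excess_height (crd_init m) = 0" "degree_height (crd_init m) = 0"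
  "eligible_arcs (crd_init m) = {}" "potential (crd_init m) = 0"
  by (auto simp: mass_height_def excess_height_def degree_height_def eligible_arcs_def eligible_def
      potential_def crd_init_def cong: if_cong)

text \<open>A relabelling must be charged \<open>3 * (hmax + 1) * deg v + 1\<close> for the
  potential and \<open>1\<close> for the step itself. Since \<open>1 \<le> deg v\<close>, this is at
  most \<open>(3 * hmax + 5) * deg v\<close>, the gain of the budget term.\<close>

lemma step_potential:
  assumes "crd_step G h C s s'" "valid s"
  shows "potential s' + 1 - (3 * real hmax + 5) * degree_height s' \<le>
    potential s - (3 * real hmax + 5) * degree_height s"
  using assms
proof cases
  case (step_push v u)
  then show ?thesis
    using potential_push[OF assms(2)] degree_height_push[OF assms(2)] by fastforce
next
  case (step_relabel v)
  note r = assms(2) step_relabel(2,3)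
  show ?thesis
    using potential_relabel[OF r] degree_height_relabel[OF r] relabel_active(3)[OF r] step_relabel(1)
    by (simp add: algebra_simps)
qed

lemma cut_flow:
  assumes "valid s" "S \<subseteq> pverts G"
  shows "(\<Sum>v\<in>S. m v - mass s v) = (\<Sum>(v, u)\<in>boundary G S. flow s v u)"
proof -
  have fin: "finite S" "finite (pverts G - S)"
    using assms(2) pair_finite_verts by (auto intro: finite_subset)
  have "(\<Sum>v\<in>S. m v - mass s v) = (\<Sum>v\<in>S. \<Sum>u\<in>pverts G. flow s v u)"
  proof (rule sum.cong[OF refl])
    fix v assume "v \<in> S"
    then have "mass s v + (\<Sum>u\<in>pverts G. flow s v u) = m v"
      using valid_balance[OF assms(1)] assms(2) by blast
    then show "m v - mass s v = (\<Sum>u\<in>pverts G. flow s v u)"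
      by linarith
  qed
  also have "\<dots> = (\<Sum>v\<in>S. (\<Sum>u\<in>S. flow s v u) + (\<Sum>u\<in>pverts G - S. flow s v u))"
    using assms(2) pair_finite_verts by (simp add: sum.subset_diff add.commute)
  \<comment> \<open>Flow between two nodes of \<open>S\<close> cancels by antisymmetry.\<close>
  also have "\<dots> = (\<Sum>v\<in>S. \<Sum>u\<in>pverts G - S. flow s v u)"
    using sum_antisym_zero[of "flow s" S, OF valid_antisym[OF assms(1)]]
    by (simp add: sum.distrib)
  also have "\<dots> = (\<Sum>(v, u)\<in>S \<times> (pverts G - S). flow s v u)"
    by (rule sum.cartesian_product)
  also have "\<dots> = (\<Sum>(v, u)\<in>boundary G S. flow s v u)"
    using fin valid_flow_arc[OF assms(1)]
    by (intro sum.mono_neutral_right) (auto simp: boundary_def)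
  finally show ?thesis .
qed

lemma total_mass_valid:
  assumes "valid s"
  shows "(\<Sum>v\<in>pverts G. mass s v) = total_mass G m"
proof -
  have "boundary G (pverts G) = {}"
    by (auto simp: boundary_def)
  then show ?thesis
    using cut_flow[OF assms subset_refl] by (simp add: sum_subtractf total_mass_def)
qed

lemma degree_height_le:
  assumes "valid s"
  shows "degree_height s \<le> total_mass G m * real hmax"
proof -
  have "degree_height s \<le> (\<Sum>v\<in>pverts G. mass s v * real hmax)"
    unfolding degree_height_def
  proof (rule sum_mono)
    fix v assume v: "v \<in> pverts G"
    show "deg v * real (lab s v) \<le> mass s v * real hmax"
    proof (cases "lab s v = 0")
      case True
      then show ?thesis
        using valid_mass_nonneg[OF assms v] by simp
    next
      case False
      then show ?thesis
        using valid_saturated[OF assms v] valid_lab_le[OF assms, of v] by (intro mult_mono) auto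
    qed
  qed
  then show ?thesis
    by (simp add: total_mass_valid[OF assms, symmetric] sum_distrib_right)
qed

text \<open>Telescoping \<open>step_potential\<close> bounds the number of steps by a multiple of
  \<open>degree_height\<close>, which is at most the total mass times \<open>hmax\<close>.\<close>

lemma no_infinite_run:
  assumes "\<sigma> 0 = crd_init m" "\<And>i. crd_step G h C (\<sigma> i) (\<sigma> (Suc i))"
  shows False
proof -
  let ?K = "3 * real hmax + 5"
  have val: "valid (\<sigma> i)" for i
    by (induction i) (use assms valid_init valid_step in auto)
  have le: "real i + potential (\<sigma> i) \<le> ?K * degree_height (\<sigma> i)" for i
  proof (induction i)
    case 0
    then show ?case by (simp add: assms(1))
  next
    case (Suc i)
    then show ?case
      using step_potential[OF assms(2) val, of i] by simp
  qed
  have "real i \<le> ?K * (total_mass G m * real hmax)" for i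
  proof -
    have "real i \<le> ?K * degree_height (\<sigma> i)"
      using le[of i] potential_nonneg[OF val, of i] by linarith
    also have "\<dots> \<le> ?K * (total_mass G m * real hmax)"
      by (intro mult_left_mono degree_height_le val) auto
    finally show ?thesis .
  qed
  then show False
    using reals_Archimedean2 linorder_not_le by blast
qed

end

section \<open>Sparse level cuts\<close>

lemma geometric_growth:
  fixes f :: "nat \<Rightarrow> real"
  assumes "0 \<le> r" "\<And>i. i < n \<Longrightarrow> r * f i \<le> f (Suc i)"
  shows "r ^ n * f 0 \<le> f n"
  using assms(2)
proof (induction n)
  case (Suc n)
  have "r * (r ^ n * f 0) \<le> r * f n"
    using Suc assms(1) by (intro mult_left_mono) auto
  also have "\<dots> \<le> f (Suc n)"
    using Suc.prems by simp
  finally show ?case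
    by (simp add: mult.assoc)
qed simp

text \<open>The quadratic bound on \<open>exp\<close> is applied at \<open>\<phi>\<close>, since
  \<open>2 * \<phi>\<close> may exceed \<open>1\<close>. Squaring \<open>1 + 2 * \<phi>\<close> then
  gives the claim because \<open>\<phi>\<^sup>2 \<le> \<phi>\<close>.\<close>

lemma exp_le_growth_factor:
  fixes \<phi> :: real
  assumes "0 \<le> \<phi>" "\<phi> \<le> 1"
  shows "exp (2 * \<phi>) \<le> 1 + 8 * \<phi>"
proof -
  have sq: "\<phi>\<^sup>2 \<le> \<phi>"
    using assms by (simp add: power2_eq_square mult_left_le)
  have "exp \<phi> \<le> 1 + \<phi> + \<phi>\<^sup>2"
    using assms by (rule exp_bound)
  then have "exp \<phi> \<le> 1 + 2 * \<phi>"
    using sq by linarith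
  then have "(exp \<phi>)\<^sup>2 \<le> (1 + 2 * \<phi>)\<^sup>2"
    by (intro power_mono) auto
  also have "\<dots> \<le> 1 + 8 * \<phi>"
    using sq by (simp add: power2_eq_square algebra_simps)
  finally show ?thesis
    by (simp add: exp_double)
qed

lemma growth_factor_power:
  fixes \<phi> M :: real
  assumes "0 < \<phi>" "\<phi> \<le> 1" "0 < M" "ln M \<le> 2 * \<phi> * real n"
  shows "M \<le> (1 + 8 * \<phi>) ^ n"
proof -
  have "M = exp (ln M)"
    using assms by simp
  also have "\<dots> \<le> exp (real n * (2 * \<phi>))"
    using assms(4) by (subst exp_le_cancel_iff) (simp add: mult_ac)
  also have "\<dots> = exp (2 * \<phi>) ^ n"
    by (rule exp_of_nat_mult)
  also have "\<dots> \<le> (1 + 8 * \<phi>) ^ n"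
    using assms by (intro power_mono exp_le_growth_factor) auto
  finally show ?thesis .
qed

section \<open>Level sets and the arcs leaving them\<close>

context crd_inner
begin

definition level :: "'a crd_state \<Rightarrow> nat \<Rightarrow> 'a set" where
  "level s i = {v \<in> pverts G. i \<le> lab s v}"

text \<open>Writing \<open>Suc\<close> instead of \<open>i - 1\<close> keeps the set empty at
  \<open>i = 0\<close>, where truncated subtraction would admit flat arcs.\<close>

definition steps_at :: "'a crd_state \<Rightarrow> nat \<Rightarrow> ('a \<times> 'a) set" where
  "steps_at s i = {(v, u) \<in> parcs G. lab s v = i \<and> Suc (lab s u) = i}"

definition drops_at :: "'a crd_state \<Rightarrow> nat \<Rightarrow> ('a \<times> 'a) set" where
  "drops_at s i = {(v, u) \<in> parcs G. lab s u < i \<and> i \<le> lab s v \<and> lab s u + 2 \<le> lab s v}"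

definition cut_vol :: "'a crd_state \<Rightarrow> nat \<Rightarrow> real" where
  "cut_vol s i = real (min (vol G (level s i)) (vol G (pverts G - level s i)))"

lemma level_subset: "level s i \<subseteq> pverts G"
  by (auto simp: level_def)

lemma finite_level: "finite (level s i)"
  using level_subset pair_finite_verts by (rule finite_subset)

lemma finite_arc_subsets: "finite (steps_at s i)" "finite (drops_at s i)"
  by (rule finite_subset[OF _ pair_finite_arcs]; auto simp: steps_at_def drops_at_def)+

lemma boundary_level:
  "boundary G (level s i) = steps_at s i \<union> drops_at s i" "steps_at s i \<inter> drops_at s i = {}"
  by (auto simp: boundary_def level_def steps_at_def drops_at_def dest: in_arcsD1 in_arcsD2)

lemma real_vol: "real (vol G S) = (\<Sum>v\<in>S. deg v)"
  by (simp add: vol_def)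

lemma vol_mono: "S \<subseteq> T \<Longrightarrow> T \<subseteq> pverts G \<Longrightarrow> vol G S \<le> vol G T"
  unfolding vol_def using pair_finite_verts by (intro sum_mono2) (auto intro: finite_subset)

lemma card_arcs_le_vol:
  assumes "S \<subseteq> pverts G" "A \<subseteq> {(v, u) \<in> parcs G. v \<in> S}"
  shows "card A \<le> vol G S"
proof -
  have "card A \<le> card (SIGMA v:S. {u. (v, u) \<in> parcs G})"
    using assms pair_finite_verts pair_finite_arcs
    by (intro card_mono) (auto intro!: finite_SigmaI intro: finite_subset dest: in_arcsD2
        simp: finite_subset[of _ "pverts G"])
  also have "\<dots> = vol G S"
    using assms pair_finite_verts
    by (subst card_SigmaI) (auto simp: vol_def card_neighbours intro: finite_subset dest: in_arcsD2)
  finally show ?thesis .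
qed

text \<open>Consecutive level sets differ by one layer \<open>B i\<close>. One-level arcs at height
  \<open>Suc i\<close> end in that layer and those at height \<open>i\<close> start in it, so its
  volume is at least either number.\<close>

lemma vol_growth:
  shows "vol G (level s (Suc i)) + card (steps_at s (Suc i)) \<le> vol G (level s i)"
    and "vol G (pverts G - level s i) + card (steps_at s i) \<le> vol G (pverts G - level s (Suc i))"
proof -
  define B where "B = (\<lambda>i. {v \<in> pverts G. lab s v = i})"
  have B: "B i \<subseteq> pverts G" "finite (B i)" for i
    using pair_finite_verts by (auto simp: B_def)
  \<comment> \<open>Reversed, these arcs leave the layer \<open>B i\<close> and can be counted by
    its volume.\<close>
  have "card (steps_at s (Suc i)) = card (prod.swap ` steps_at s (Suc i))"
    by (intro card_image[symmetric] inj_onI) (metis swap_swap)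
  also have "\<dots> \<le> vol G (B i)"
    using arc_swap by (intro card_arcs_le_vol) (auto simp: steps_at_def B_def dest: in_arcsD2)
  finally have "vol G (level s (Suc i)) + card (steps_at s (Suc i)) \<le> vol G (level s (Suc i)) + vol G (B i)"
    by simp
  also have "\<dots> = vol G (level s (Suc i) \<union> B i)"
    unfolding vol_def using finite_level B by (intro sum.union_disjoint[symmetric]) (auto simp: level_def B_def)
  also have "level s (Suc i) \<union> B i = level s i"
    by (auto simp: level_def B_def)
  finally show "vol G (level s (Suc i)) + card (steps_at s (Suc i)) \<le> vol G (level s i)" .
  have "card (steps_at s i) \<le> vol G (B i)"
    by (intro card_arcs_le_vol) (auto simp: steps_at_def B_def dest: in_arcsD1)
  then have "vol G (pverts G - level s i) + card (steps_at s i) \<le> vol G (pverts G - level s i) + vol G (B i)"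
    by simp
  also have "\<dots> = vol G ((pverts G - level s i) \<union> B i)"
    unfolding vol_def using pair_finite_verts B by (intro sum.union_disjoint[symmetric]) (auto simp: level_def B_def)
  also have "(pverts G - level s i) \<union> B i = pverts G - level s (Suc i)"
    by (auto simp: level_def B_def)
  finally show "vol G (pverts G - level s i) + card (steps_at s i) \<le> vol G (pverts G - level s (Suc i))" .
qed

text \<open>
  The net flow out of a level set is at most twice the volume of either side, since masses lie
  between \<open>0\<close> and twice the degree on both sides. Arcs dropping one level may carry up to \<open>C\<close> backwards.
\<close>

lemma drops_at_bound:
  assumes "valid s" "1 \<le> i"
  shows "real (card (drops_at s i)) * min (real i / 2) C \<le> 2 * cut_vol s i + real (card (steps_at s i)) * C"
proof -
  let ?S = "level s i" and ?T = "pverts G - level s i"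
  define c where "c = min (real i / 2) C"
  let ?net = "\<Sum>v\<in>?S. m v - mass s v"
  have le: "m v - mass s v \<le> 2 * deg v" "mass s v - m v \<le> 2 * deg v" if "v \<in> pverts G" for v
    using that init_nonneg init_le valid_mass_nonneg[OF assms(1)] valid_mass_le[OF assms(1)]
    by (smt (verit))+
  have "?net \<le> (\<Sum>v\<in>?S. 2 * deg v)"
    by (intro sum_mono le) (auto simp: level_def)
  then have net_S: "?net \<le> 2 * real (vol G ?S)"
    by (simp add: real_vol sum_distrib_left)
  \<comment> \<open>By conservation, what leaves the level set arrives in its complement; this
    yields the bound by the volume of the other side.\<close>
  have "(\<Sum>v\<in>pverts G. m v - mass s v) = 0"
    using total_mass_valid[OF assms(1)] by (simp add: sum_subtractf total_mass_def)
  then have "?net = (\<Sum>v\<in>?T. mass s v - m v)"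
    using sum.subset_diff[OF level_subset pair_finite_verts, of "\<lambda>v. m v - mass s v" s i]
    by (simp add: sum_subtractf)
  also have "\<dots> \<le> (\<Sum>v\<in>?T. 2 * deg v)"
    by (intro sum_mono le) auto
  finally have net_T: "?net \<le> 2 * real (vol G ?T)"
    by (simp add: real_vol sum_distrib_left)
  have drop: "c \<le> flow s v u" if "(v, u) \<in> drops_at s i" for v u
  proof -
    have "min (real (lab s v) - 1) C \<le> flow s v u"
      using that by (intro valid_drop[OF assms(1)]) (auto simp: drops_at_def)
    \<comment> \<open>The label is at least \<open>2\<close> and at least \<open>i\<close>, so
      subtracting one at most halves it.\<close>
    moreover have "real i / 2 \<le> real (lab s v) - 1"
      using that by (auto simp: drops_at_def)
    ultimately show ?thesis
      unfolding c_def by linarith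
  qed
  have step: "- C \<le> flow s v u" for v u
    using valid_antisym[OF assms(1), of v u] valid_flow_le[OF assms(1), of u v] by linarith
  have "real (card (drops_at s i)) * c - real (card (steps_at s i)) * C =
      (\<Sum>p\<in>steps_at s i. - C) + (\<Sum>p\<in>drops_at s i. c)"
    by simp
  also have "\<dots> \<le> (\<Sum>(v, u)\<in>steps_at s i. flow s v u) + (\<Sum>(v, u)\<in>drops_at s i. flow s v u)"
    by (intro add_mono sum_mono) (use drop step in auto)
  also have "\<dots> = ?net"
    unfolding cut_flow[OF assms(1) level_subset] boundary_level(1)
    by (intro sum.union_disjoint[symmetric] finite_arc_subsets boundary_level)
  also have "\<dots> \<le> 2 * cut_vol s i"
    using net_S net_T by (simp add: cut_vol_def)
  finally show ?thesis
    by (simp add: c_def)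
qed

text \<open>From \<open>C / 4 \<le> real i\<close> the flow bound per dropping arc is at least
  \<open>C / 8\<close>, so their number is at most \<open>16 * \<phi> * cut_vol s i\<close> plus
  eight times the number of one-level arcs. Adding the one-level arcs themselves gives
  \<open>16 + 9 * 8 = 88\<close>.\<close>

lemma conductance_level:
  assumes "valid s" "0 < \<phi>" "C = 1 / \<phi>" "1 \<le> i" "C / 4 \<le> real i" "0 < cut_vol s i"
    and steps: "real (card (steps_at s i)) \<le> 8 * \<phi> * cut_vol s i"
  shows "conductance G (level s i) \<le> 88 * \<phi>"
proof -
  let ?z1 = "real (card (steps_at s i))" and ?z2 = "real (card (drops_at s i))"
  have "?z2 * (C / 8) \<le> ?z2 * min (real i / 2) C"
    using assms(5) C_nonneg by (intro mult_left_mono) auto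
  also have "\<dots> \<le> 2 * cut_vol s i + ?z1 * C"
    by (rule drops_at_bound[OF assms(1,4)])
  finally have "?z2 \<le> 16 * \<phi> * cut_vol s i + 8 * ?z1"
    using assms(2) by (simp add: assms(3) field_simps)
  then have "?z1 + ?z2 \<le> 88 * \<phi> * cut_vol s i"
    using steps by linarith
  moreover have "real (card (boundary G (level s i))) = ?z1 + ?z2"
    by (simp add: boundary_level card_Un_disjoint finite_arc_subsets)
  ultimately have "real (card (boundary G (level s i))) \<le> 88 * \<phi> * cut_vol s i"
    by simp
  then show ?thesis
    using assms(6) by (simp add: conductance_def cut_vol_def[symmetric] divide_le_eq)
qed

section \<open>Halted states with remaining excess\<close>

context
  fixes s w
  assumes final: "valid s" "crd_halted G h s" and w: "w \<in> pverts G" "deg w < mass s w"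
    and h_pos: "0 < h" and total_le: "total_mass G m \<le> real (vol G (pverts G))"
begin

text \<open>A node with excess can be inactive only because its label has reached \<open>h\<close>,
  hence its ceiling.\<close>

lemma final_excess_lab: "v \<in> pverts G \<Longrightarrow> deg v < mass s v \<Longrightarrow> hmax \<le> lab s v"
  using final(2) unfolding crd_halted_def active_def excess_def hmax_def
  by (metis diff_gt_0_iff_gt less_max_iff_disj nat_ceiling_le_eq not_le)

lemma hmax_pos: "1 \<le> hmax"
  using h_pos by (simp add: hmax_def Suc_le_eq)

text \<open>The node \<open>w\<close> lies in all these level sets and has positive degree. This is
  the initial value for the downward growth.\<close>

lemma final_vol_level: "i \<le> hmax \<Longrightarrow> 1 \<le> vol G (level s i)"
proof -
  assume i: "i \<le> hmax"
  have "0 < deg w"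
    using w valid_mass_le[OF final(1)] by fastforce
  then have "1 \<le> out_degree G w"
    by simp
  also have "\<dots> = vol G {w}"
    by (simp add: vol_def)
  also have "\<dots> \<le> vol G (level s i)"
    using final_excess_lab[OF w] w i by (intro vol_mono) (auto simp: level_def)
  finally show ?thesis .
qed

text \<open>Nodes of positive label hold at least their degree, and \<open>w\<close> holds strictly
  more. The strict inequality also forces positive volume on the complement.\<close>

lemma final_vol_level_less: "1 \<le> i \<Longrightarrow> real (vol G (level s i)) < total_mass G m"
proof -
  assume i: "1 \<le> i"
  have "real (vol G (level s i)) \<le> real (vol G (level s 1))"
    using i by (simp, intro vol_mono) (auto simp: level_def)
  also have "\<dots> < (\<Sum>v\<in>level s 1. mass s v)"
    unfolding real_vol
  proof (rule sum_strict_mono_ex1[OF finite_level])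
    show "\<forall>v\<in>level s 1. deg v \<le> mass s v"
      using valid_saturated[OF final(1)] by (auto simp: level_def)
    show "\<exists>v\<in>level s 1. deg v < mass s v"
      using w final_excess_lab[OF w] hmax_pos by (auto simp: level_def)
  qed
  also have "\<dots> \<le> (\<Sum>v\<in>pverts G. mass s v)"
    using valid_mass_nonneg[OF final(1)]
    by (intro sum_mono2 level_subset pair_finite_verts) auto
  also have "\<dots> = total_mass G m"
    by (rule total_mass_valid[OF final(1)])
  finally show ?thesis .
qed

lemma vol_split: "vol G (pverts G) = vol G (pverts G - level s i) + vol G (level s i)"
  unfolding vol_def by (rule sum.subset_diff[OF level_subset pair_finite_verts])

lemma final_vol_compl: "1 \<le> i \<Longrightarrow> 1 \<le> vol G (pverts G - level s i)"
  using final_vol_level_less[of i] total_le vol_split[of i] by linarith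

text \<open>
  If no level were sparse, then growing a level set down from \<open>hmax\<close>, or growing the complement up
  from height \<open>C / 4\<close>, whichever stays below half of the total volume, multiplies the volume by
  \<open>1 + 8 * \<phi>\<close> in each of at least \<open>C * ln M / 2\<close> steps, hence by a factor of at least \<open>M\<close>.
\<close>

lemma exists_sparse_level:
  assumes "0 < \<phi>" "\<phi> \<le> 1" "C = 1 / \<phi>" "h = crd_height G m \<phi>" "2 \<le> total_mass G m"
  obtains i where "1 \<le> i" "i \<le> hmax" "C / 4 \<le> real i"
    "real (card (steps_at s i)) \<le> 8 * \<phi> * cut_vol s i"
proof (rule ccontr)
  assume no: "\<not> thesis"
  note sparse = that
  define M where "M = total_mass G m"
  define L where "L = ln M"
  \<comment> \<open>Height \<open>a\<close> is where \<open>C / 4 \<le> real i\<close> starts to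
    hold; \<open>b\<close> is about \<open>h / 3\<close>, so that enough levels lie both between
    \<open>a\<close> and \<open>b\<close> and above \<open>b\<close>.\<close>
  define a where "a = nat \<lceil>C / 4\<rceil>"
  define b where "b = nat \<lceil>C * L\<rceil>"
  have C: "1 \<le> C"
    using assms by simp
  have "ln 2 \<le> L"
    using assms by (simp add: L_def M_def)
  then have L: "2 / 3 \<le> L"
    using ln2_ge_two_thirds by linarith
  have h: "h = 3 * (C * L)"
    using assms by (simp add: crd_height_def M_def L_def)
  have CL: "2 / 3 \<le> C * L" "C / 4 \<le> C * L / 2"
    using mult_mono[OF C L] L C by (auto simp: field_simps)
  have a: "C / 4 \<le> real a" "real a < C / 4 + 1" "1 \<le> a"
    using C by (simp_all add: a_def) linarith+
  have b: "C * L \<le> real b" "real b < C * L + 1" "1 \<le> b"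
    using CL by (simp_all add: b_def) linarith+
  have hm: "3 * (C * L) \<le> real hmax"
  proof -
    have "h \<le> real hmax"
      unfolding hmax_def by linarith
    then show ?thesis
      using h by linarith
  qed
  have ab: "a \<le> Suc b" "b \<le> hmax"
    using a b hm CL by linarith+
  have dense: "8 * \<phi> * cut_vol s i < real (card (steps_at s i))"
    if "a \<le> i" "i \<le> hmax" for i
  proof (rule ccontr)
    assume "\<not> ?thesis"
    then show False
      using no sparse[of i] that a by simp
  qed
  have power: "M \<le> (1 + 8 * \<phi>) ^ n" if "C * L / 2 \<le> real n" for n
  proof (rule growth_factor_power)
    have "\<phi> * (C * L / 2) \<le> \<phi> * real n"
      using that assms by (intro mult_left_mono) auto
    then show "ln M \<le> 2 * \<phi> * real n"
      using assms by (simp add: L_def)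
  qed (use assms M_def in auto)
  show False
  \<comment> \<open>This decides the smaller side uniformly: either all level sets above
    \<open>b\<close> have at most half the volume, or all those up to \<open>b\<close> have more
    than half.\<close>
  proof (cases "2 * vol G (level s (Suc b)) \<le> vol G (pverts G)")
    case True
    define f where "f j = real (vol G (level s (hmax - j)))" for j
    have grow: "(1 + 8 * \<phi>) * f j \<le> f (Suc j)" if j: "j < hmax - b" for j
    proof -
      define i where "i = hmax - j"
      have i: "Suc b \<le> i" "a \<le> i" "i \<le> hmax" "i = Suc (hmax - Suc j)"
        using j ab by (auto simp: i_def)
      have "vol G (level s i) \<le> vol G (level s (Suc b))"
        using i by (intro vol_mono) (auto simp: level_def)
      then have "cut_vol s i = real (vol G (level s i))"
        using True vol_split[of i] by (simp add: cut_vol_def)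
      then show ?thesis
        using dense[OF i(2,3)] vol_growth(1)[of s "hmax - Suc j"] i(4)
        by (simp add: f_def i_def[symmetric] algebra_simps)
    qed
    have "1 \<le> f 0"
      using final_vol_level[of hmax] by (simp add: f_def)
    \<comment> \<open>There are more than \<open>2 * C * L - 1\<close> steps, which is at least
      \<open>C * L / 2\<close> because \<open>2 / 3 \<le> C * L\<close>.\<close>
    have "M * 1 \<le> (1 + 8 * \<phi>) ^ (hmax - b) * f 0"
      using b hm CL ab assms \<open>1 \<le> f 0\<close> by (intro mult_mono power) (auto simp: of_nat_diff)
    also have "\<dots> \<le> f (hmax - b)"
      using assms by (intro geometric_growth grow) auto
    finally have "M \<le> real (vol G (level s b))"
      using ab by (simp add: f_def)
    then show False
      using final_vol_level_less[OF b(3)] by (simp add: M_def)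
  next
    case False
    define f where "f j = real (vol G (pverts G - level s (a + j)))" for j
    have grow: "(1 + 8 * \<phi>) * f j \<le> f (Suc j)" if j: "j < Suc b - a" for j
    proof -
      define i where "i = a + j"
      have i: "i \<le> b" "a \<le> i" "i \<le> hmax"
        using j ab by (auto simp: i_def)
      have "vol G (level s (Suc b)) \<le> vol G (level s i)"
        using i by (intro vol_mono) (auto simp: level_def)
      then have "cut_vol s i = real (vol G (pverts G - level s i))"
        using False vol_split[of i] by (simp add: cut_vol_def)
      then show ?thesis
        using dense[OF i(2,3)] vol_growth(2)[of s i]
        by (simp add: f_def i_def[symmetric] algebra_simps)
    qed
    have "1 \<le> f 0"
      using final_vol_compl[OF a(3)] by (simp add: f_def)
    \<comment> \<open>There are more than \<open>C * L - C / 4\<close> steps, which is at least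
      \<open>C * L / 2\<close>.\<close>
    have "M * 1 \<le> (1 + 8 * \<phi>) ^ (Suc b - a) * f 0"
      using a b CL ab assms \<open>1 \<le> f 0\<close> by (intro mult_mono power) (auto simp: of_nat_diff)
    also have "\<dots> \<le> f (Suc b - a)"
      using assms by (intro geometric_growth grow) auto
    finally have "M \<le> real (vol G (pverts G - level s (Suc b)))"
      using ab by (simp add: f_def)
    \<comment> \<open>The complement now has volume at least \<open>M\<close>, yet it is smaller
      than the level set, whose volume is below \<open>M\<close>.\<close>
    then show False
      using final_vol_level_less[of "Suc b"] False vol_split[of "Suc b"] by (simp add: M_def)
  qed
qed

text \<open>All excess sits at labels of at least \<open>hmax\<close>, so every level between
  \<open>1\<close> and \<open>hmax\<close> meets the mass conditions on the cut; only sparsity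
  restricts the choice.\<close>

lemma final_level_mass:
  assumes "1 \<le> i" "i \<le> hmax"
  shows "v \<in> level s i \<Longrightarrow> deg v \<le> mass s v \<and> mass s v \<le> 2 * deg v"
    and "v \<in> pverts G - level s i \<Longrightarrow> mass s v \<le> deg v"
  using assms valid_saturated[OF final(1)] valid_mass_le[OF final(1)] final_excess_lab[of v]
  by (fastforce simp: level_def)+

end

end

section \<open>Running time\<close>

context crd_inner
begin

section \<open>Initially active nodes and granularity of mass\<close>

lemma active_init_card_le: "real (card {v. active G h (crd_init m) v}) \<le> total_mass G m"
proof -
  let ?A = "{v. active G h (crd_init m) v}"
  have A: "?A \<subseteq> pverts G"
    by (auto simp: active_def)
  \<comment> \<open>An active node has positive degree, which is an integer, and holds more mass
    than that.\<close>
  have "1 \<le> m v" if "v \<in> ?A" for v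
  proof -
    have "deg v < m v" "v \<in> pverts G"
      using that A active_deg_less[of "crd_init m" v] by (auto simp: crd_init_def)
    moreover from this have "0 < deg v"
      using init_le[of v] by linarith
    ultimately show ?thesis
      by simp
  qed
  then have "real (card ?A) \<le> (\<Sum>v\<in>?A. m v)"
    using sum_mono[of ?A "\<lambda>_. 1" m] by simp
  also have "\<dots> \<le> total_mass G m"
    unfolding total_mass_def using A init_nonneg by (intro sum_mono2 pair_finite_verts) auto
  finally show ?thesis .
qed

definition granular_state :: "nat \<Rightarrow> 'a crd_state \<Rightarrow> bool" where
  "granular_state N s \<longleftrightarrow>
     (\<forall>v\<in>pverts G. real N * mass s v \<in> \<int>) \<and> (\<forall>v u. real N * flow s v u \<in> \<int>)"

lemma granular_push_amount:
  assumes "granular_state N s" "real N * C \<in> \<int>" "v \<in> pverts G" "u \<in> pverts G"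
  shows "real N * push_amount G C s v u \<in> \<int>"
proof -
  have m: "real N * mass s v \<in> \<int>" "real N * mass s u \<in> \<int>" and f: "real N * flow s v u \<in> \<int>"
    using assms by (auto simp: granular_state_def)
  have "real N * excess G s v \<in> \<int>"
    using m by (auto simp: excess_def max_def right_diff_distrib)
  moreover have "real N * residual C s v u \<in> \<int>"
    using f assms(2) by (auto simp: residual_def min_def right_diff_distrib)
  moreover have "real N * (2 * deg u - mass s u) \<in> \<int>"
    using m by (auto simp: right_diff_distrib)
  ultimately show ?thesis
    by (auto simp: push_amount_def min_def)
qed

lemma granular_push:
  assumes "granular_state N s" "real N * C \<in> \<int>" "v \<in> pverts G" "u \<in> pverts G" "v \<noteq> u"
  shows "granular_state N (push G C s v u)"
  using assms(1) granular_push_amount[OF assms(1-4)] assms(3-5)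
  by (auto simp: granular_state_def push_fields netted_def distrib_left right_diff_distrib)

lemma granular_relabel: "granular_state N s \<Longrightarrow> granular_state N (relabel s v)"
  by (simp add: granular_state_def relabel_fields)

text \<open>A positive integer is at least one, so every push moves at least
  \<open>1 / N\<close>.\<close>

lemma granular_push_amount_ge:
  assumes "valid s" "lowest_active G h s v" "eligible G C s v u"
    and "granular_state N s" "real N * C \<in> \<int>" "1 \<le> N"
  shows "1 \<le> real N * push_amount G C s v u"
proof -
  note facts = push_facts[OF assms(1-3)]
  have "0 < real N * push_amount G C s v u"
    using facts(1) assms(6) by simp
  then show ?thesis
    using granular_push_amount[OF assms(4,5) facts(7,8)] by (auto elim!: Ints_cases)
qed

section \<open>Amortised analysis of the implementation\<close>

context
  fixes adj :: "'a \<Rightarrow> 'a list"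
  assumes adj: "adjacency_lists G adj"
begin

text \<open>Arcs already passed stay ineligible until their tail is relabelled, which resets the
  pointer. The mass condition for advanced pointers serves to bound \<open>ptr_sum\<close>; the
  guard \<open>ptr v > 0\<close> makes room for isolated nodes, whose adjacency list is
  empty.\<close>

definition impl_valid :: "'a crd_state \<Rightarrow> ('a \<Rightarrow> nat) \<Rightarrow> bool" where
  "impl_valid s ptr \<longleftrightarrow> valid s \<and>
     (\<forall>v\<in>pverts G. ptr v > 0 \<longrightarrow> ptr v < length (adj v) \<and> deg v \<le> mass s v) \<and>
     (\<forall>v\<in>pverts G. \<forall>k<ptr v. \<not> eligible G C s v (adj v ! k))"

definition ptr_sum :: "('a \<Rightarrow> nat) \<Rightarrow> real" where
  "ptr_sum ptr = (\<Sum>v\<in>pverts G. real (ptr v))"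

lemma ptr_sum_upd: "v \<in> pverts G \<Longrightarrow> ptr_sum (ptr(v := k)) = ptr_sum ptr + real k - real (ptr v)"
  unfolding ptr_sum_def
  by (subst sum_change_one[where v = v and f = "\<lambda>x. real (ptr x)"]) (auto simp: pair_finite_verts)

lemma adj_set: "v \<in> pverts G \<Longrightarrow> set (adj v) = {u. (v, u) \<in> parcs G}"
  using adj by (auto simp: adjacency_lists_def)

lemma adj_length: "v \<in> pverts G \<Longrightarrow> length (adj v) = out_degree G v"
  using adj by (metis adjacency_lists_def card_neighbours distinct_card)

lemma impl_step_cases [consumes 2, case_names push advance relabel]:
  assumes "crd_impl_step G h C adj (s, ptr) (s', ptr')" "impl_valid s ptr"
  obtains (push) v u where "lowest_active G h s v" "eligible G C s v u"
      "s' = push G C s v u" "ptr' = ptr"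
  | (advance) v where "v \<in> pverts G" "deg v < mass s v" "\<not> eligible G C s v (adj v ! ptr v)"
      "Suc (ptr v) < length (adj v)" "s' = s" "ptr' = ptr(v := Suc (ptr v))"
  | (relabel) v where "lowest_active G h s v" "\<forall>u. \<not> eligible G C s v u"
      "real (ptr v) + 1 \<le> deg v" "s' = relabel s v" "ptr' = ptr(v := 0)"
  using assms(1)
proof cases
  case (impl_push v u)
  then show ?thesis using push by blast
next
  case (impl_advance v)
  then have "v \<in> pverts G" "deg v < mass s v"
    using active_deg_less by (auto simp: lowest_active_def active_def)
  then show ?thesis using advance impl_advance by blast
next
  case (impl_relabel v)
  then have v: "v \<in> pverts G" "deg v < mass s v"
    using active_deg_less by (auto simp: lowest_active_def active_def)
  have "mass s v \<le> 2 * deg v"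
    using assms(2) v valid_mass_le by (auto simp: impl_valid_def)
  \<comment> \<open>Excess within the bound \<open>2 * deg v\<close> forces positive degree, so even
    a pointer at \<open>0\<close> refers to a genuine list entry.\<close>
  then have "0 < length (adj v)"
    using v adj_length by auto
  then have "ptr v < length (adj v)"
    using assms(2) v(1) by (cases "ptr v = 0") (auto simp: impl_valid_def)
  then have last: "Suc (ptr v) = length (adj v)"
    using impl_relabel by linarith
  have "\<not> eligible G C s v u" for u
  proof
    assume el: "eligible G C s v u"
    then have "u \<in> set (adj v)"
      using adj_set[OF v(1)] by (auto simp: eligible_def)
    then obtain k where k: "k < length (adj v)" "adj v ! k = u"
      by (auto simp: in_set_conv_nth)
    then consider "k < ptr v" | "k = ptr v"
      using last by linarith
    then show False
      using el k v impl_relabel assms(2) by cases (auto simp: impl_valid_def)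
  qed
  moreover have "real (ptr v) + 1 \<le> deg v"
    using last adj_length[OF v(1)] by linarith
  ultimately show ?thesis
    using relabel impl_relabel by blast
qed

text \<open>An advance is paid for by \<open>ptr_sum\<close>. A relabelling gives back at most
  \<open>deg v - 1\<close> of it, which the budget terms also absorb. Pushes are charged to
  \<open>potential\<close> in general and to \<open>real N * mass_height s\<close> in the granular
  case.\<close>

lemma impl_step:
  assumes "crd_impl_step G h C adj (s, ptr) (s', ptr')" "impl_valid s ptr"
  shows impl_valid_step: "impl_valid s' ptr'"
    and impl_step_crd_step: "crd_step G h C s s' \<or> s' = s"
    and impl_step_potential:
      "potential s' + 1 - (3 * real hmax + 5) * degree_height s' - ptr_sum ptr' \<le>
       potential s - (3 * real hmax + 5) * degree_height s - ptr_sum ptr"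
    and impl_step_granular: "granular_state N s \<Longrightarrow> real N * C \<in> \<int> \<Longrightarrow> granular_state N s'"
    and impl_step_mass_height:
      "granular_state N s \<Longrightarrow> real N * C \<in> \<int> \<Longrightarrow> 1 \<le> N \<Longrightarrow>
       real N * mass_height s' + 1 - (1 + 2 * real N) * degree_height s' - ptr_sum ptr' \<le>
       real N * mass_height s - (1 + 2 * real N) * degree_height s - ptr_sum ptr"
proof -
  have V: "valid s"
    using assms(2) by (simp add: impl_valid_def)
  from assms have "impl_valid s' ptr' \<and> (crd_step G h C s s' \<or> s' = s) \<and>
      potential s' + 1 - (3 * real hmax + 5) * degree_height s' - ptr_sum ptr' \<le>
        potential s - (3 * real hmax + 5) * degree_height s - ptr_sum ptr \<and>
      (granular_state N s \<longrightarrow> real N * C \<in> \<int> \<longrightarrow> granular_state N s') \<and>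
      (granular_state N s \<longrightarrow> real N * C \<in> \<int> \<longrightarrow> 1 \<le> N \<longrightarrow>
        real N * mass_height s' + 1 - (1 + 2 * real N) * degree_height s' - ptr_sum ptr' \<le>
        real N * mass_height s - (1 + 2 * real N) * degree_height s - ptr_sum ptr)"
  proof (cases rule: impl_step_cases)
    case (push v u)
    note p = V push(1,2)
    note facts = push_facts[OF p]
    have "impl_valid s' ptr'"
      using assms(2) valid_push[OF p] saturated_push[OF p] eligible_push[OF p]
      unfolding impl_valid_def push(3,4) by blast
    moreover have "crd_step G h C s s'"
      using push by (auto intro: crd_step.intros)
    moreover have "granular_state N s'" if "granular_state N s" "real N * C \<in> \<int>"
      using granular_push[OF that facts(7-9)] push by simp
    moreover have "real N * mass_height s' + 1 \<le> real N * mass_height s"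
      if "granular_state N s" "real N * C \<in> \<int>" "1 \<le> N"
    proof -
      have "real N * mass_height s' \<le> real N * (mass_height s - push_amount G C s v u)"
        using mass_height_push[OF p] push(3) by (intro mult_left_mono) auto
      then show ?thesis
        using granular_push_amount_ge[OF p that] by (simp add: right_diff_distrib)
    qed
    ultimately show ?thesis
      using potential_push[OF p] degree_height_push[OF p] push(3,4) by simp
  next
    case (advance v)
    have "impl_valid s' ptr'"
      using assms(2) advance unfolding impl_valid_def by (auto simp: less_Suc_eq)
    then show ?thesis
      using advance by (simp add: ptr_sum_upd)
  next
    case (relabel v)
    note r = V relabel(1,2)
    note v = relabel_active[OF r]
    have "impl_valid s' ptr'"
      using assms(2) valid_relabel[OF r] eligible_relabel[of s v]
      unfolding impl_valid_def relabel(4,5) relabel_fields(1) fun_upd_apply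
      by (metis less_nat_zero_code)
    moreover have "crd_step G h C s s'"
      using relabel by (auto intro: crd_step.intros)
    moreover have "granular_state N s'" if "granular_state N s"
      using granular_relabel[OF that] relabel by simp
    moreover have "real N * mass_height s' \<le> real N * (mass_height s + 2 * deg v)"
      using mass_height_relabel[OF r] relabel(4) by (intro mult_left_mono) auto
    ultimately show ?thesis
      using potential_relabel[OF r] degree_height_relabel[OF r] v relabel(3-5)
      by (simp add: ptr_sum_upd algebra_simps)
  qed
  then show "impl_valid s' ptr'" "crd_step G h C s s' \<or> s' = s"
      "potential s' + 1 - (3 * real hmax + 5) * degree_height s' - ptr_sum ptr' \<le>
        potential s - (3 * real hmax + 5) * degree_height s - ptr_sum ptr"
      "granular_state N s \<Longrightarrow> real N * C \<in> \<int> \<Longrightarrow> granular_state N s'"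
      "granular_state N s \<Longrightarrow> real N * C \<in> \<int> \<Longrightarrow> 1 \<le> N \<Longrightarrow>
        real N * mass_height s' + 1 - (1 + 2 * real N) * degree_height s' - ptr_sum ptr' \<le>
        real N * mass_height s - (1 + 2 * real N) * degree_height s - ptr_sum ptr"
    by blast+
qed

lemma impl_run:
  assumes "(crd_impl_step G h C adj ^^ n) (crd_impl_init m) (s, ptr)"
  shows "impl_valid s ptr \<and> (crd_step G h C)\<^sup>*\<^sup>* (crd_init m) s \<and>
    real n + potential s \<le> (3 * real hmax + 5) * degree_height s + ptr_sum ptr"
  using assms
proof (induction n arbitrary: s ptr)
  case 0
  then show ?case
    using valid_init by (auto simp: crd_impl_init_def impl_valid_def ptr_sum_def)
next
  case (Suc n)
  then obtain s1 ptr1 where run: "(crd_impl_step G h C adj ^^ n) (crd_impl_init m) (s1, ptr1)"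
    and step: "crd_impl_step G h C adj (s1, ptr1) (s, ptr)"
    by (auto elim!: relpowp_Suc_E)
  note IH = Suc.IH[OF run]
  then have "impl_valid s1 ptr1"
    by blast
  note st = impl_step[OF step this]
  have "(crd_step G h C)\<^sup>*\<^sup>* (crd_init m) s"
    using IH st(2) by (auto intro: rtranclp.rtrancl_into_rtrancl)
  then show ?case
    using IH st(1,3) by simp
qed

lemma impl_run_granular:
  assumes "(crd_impl_step G h C adj ^^ n) (crd_impl_init m) (s, ptr)"
    and N: "1 \<le> N" "real N * C \<in> \<int>" "\<forall>v\<in>pverts G. real N * m v \<in> \<int>"
  shows "granular_state N s \<and>
    real n + real N * mass_height s \<le> (1 + 2 * real N) * degree_height s + ptr_sum ptr"
  using assms(1)
proof (induction n arbitrary: s ptr)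
  case 0
  then show ?case
    using N by (auto simp: crd_impl_init_def granular_state_def ptr_sum_def)
      (auto simp: crd_init_def)
next
  case (Suc n)
  then obtain s1 ptr1 where run: "(crd_impl_step G h C adj ^^ n) (crd_impl_init m) (s1, ptr1)"
    and step: "crd_impl_step G h C adj (s1, ptr1) (s, ptr)"
    by (auto elim!: relpowp_Suc_E)
  have "impl_valid s1 ptr1"
    using impl_run[OF run] by blast
  note st = impl_step[OF step this]
  show ?case
    using Suc.IH[OF run] st(4)[of N] st(5)[of N] N by simp
qed

text \<open>A node with an advanced pointer holds at least its degree, which exceeds the
  pointer.\<close>

lemma ptr_sum_le:
  assumes "impl_valid s ptr"
  shows "ptr_sum ptr \<le> total_mass G m"
proof -
  have V: "valid s"
    using assms by (simp add: impl_valid_def)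
  have "ptr_sum ptr \<le> (\<Sum>v\<in>pverts G. mass s v)"
    unfolding ptr_sum_def
  proof (rule sum_mono)
    fix v assume v: "v \<in> pverts G"
    show "real (ptr v) \<le> mass s v"
    proof (cases "ptr v = 0")
      case True
      then show ?thesis
        using valid_mass_nonneg[OF V v] by simp
    next
      case False
      then have "ptr v < out_degree G v" "deg v \<le> mass s v"
        using assms v adj_length[OF v] by (auto simp: impl_valid_def)
      then show ?thesis
        by linarith
    qed
  qed
  then show ?thesis
    by (simp add: total_mass_valid[OF V])
qed

text \<open>The summand \<open>2\<close> covers the initial list of active nodes and the final
  pointer positions, each bounded by the total mass.\<close>

lemma impl_time:
  assumes "(crd_impl_step G h C adj ^^ n) (crd_impl_init m) (s, ptr)"
  shows "real (crd_time G h m n) \<le> total_mass G m * (2 + (3 * real hmax + 5) * real hmax)"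
proof -
  note run = impl_run[OF assms]
  then have V: "valid s" and IV: "impl_valid s ptr"
    by (auto simp: impl_valid_def)
  have "(3 * real hmax + 5) * degree_height s \<le> (3 * real hmax + 5) * (total_mass G m * real hmax)"
    by (intro mult_left_mono degree_height_le[OF V]) auto
  then have "real n \<le> (3 * real hmax + 5) * (total_mass G m * real hmax) + total_mass G m"
    using run ptr_sum_le[OF IV] potential_nonneg[OF V] by linarith
  then show ?thesis
    using active_init_card_le by (simp add: crd_time_def algebra_simps)
qed

lemma impl_time_granular:
  assumes "(crd_impl_step G h C adj ^^ n) (crd_impl_init m) (s, ptr)"
    and N: "1 \<le> N" "real N * C \<in> \<int>" "\<forall>v\<in>pverts G. real N * m v \<in> \<int>"
  shows "real (crd_time G h m n) \<le> total_mass G m * (2 + (1 + 2 * real N) * real hmax)"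
proof -
  have V: "valid s" and IV: "impl_valid s ptr"
    using impl_run[OF assms(1)] by (auto simp: impl_valid_def)
  have "(1 + 2 * real N) * degree_height s \<le> (1 + 2 * real N) * (total_mass G m * real hmax)"
    by (intro mult_left_mono degree_height_le[OF V]) auto
  moreover have "0 \<le> real N * mass_height s"
    using mass_height_nonneg[OF V] by simp
  ultimately have "real n \<le> (1 + 2 * real N) * (total_mass G m * real hmax) + total_mass G m"
    using impl_run_granular[OF assms] ptr_sum_le[OF IV] by linarith
  then show ?thesis
    using active_init_card_le by (simp add: crd_time_def algebra_simps)
qed

end

section \<open>Numerical bounds and the final cut\<close>

lemma hmax_le:
  assumes "0 < \<phi>" "\<phi> \<le> 1" "h = crd_height G m \<phi>" "2 \<le> total_mass G m"
  defines "x \<equiv> ln (total_mass G m) / \<phi>"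
  shows "1 / 2 \<le> x" "real hmax \<le> 5 * x"
proof -
  have "ln 2 \<le> ln (total_mass G m)"
    using assms(4) by simp
  then have "1 / 2 \<le> ln (total_mass G m)"
    using ln2_ge_two_thirds by linarith
  also have "\<dots> \<le> x"
    using assms(1,2) \<open>1 / 2 \<le> ln (total_mass G m)\<close>
    by (simp add: x_def pos_le_divide_eq mult_left_le)
  finally show x: "1 / 2 \<le> x" .
  have "h = 3 * x"
    using assms(3) by (simp add: crd_height_def x_def)
  \<comment> \<open>Rounding up costs less than one, and \<open>1 \<le> 2 * x\<close> absorbs
    it.\<close>
  then have "real hmax \<le> 3 * x + 1"
    using x unfolding hmax_def by linarith
  then show "real hmax \<le> 5 * x"
    using x by linarith
qed

text \<open>The estimates yield the constants \<open>8 + 125 = 133\<close> and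
  \<open>4 + 15 = 19\<close>; \<open>150\<close> is a round value that also dominates the
  conductance constant \<open>88\<close>.\<close>

lemma time_bounds:
  assumes "0 < \<phi>" "\<phi> \<le> 1" "h = crd_height G m \<phi>" "2 \<le> total_mass G m"
  defines "x \<equiv> ln (total_mass G m) / \<phi>"
  shows "total_mass G m * (2 + (3 * real hmax + 5) * real hmax) \<le> 150 * (total_mass G m * x\<^sup>2)"
    and "1 \<le> N \<Longrightarrow> total_mass G m * (2 + (1 + 2 * real N) * real hmax) \<le>
      150 * real N * (total_mass G m * x)"
proof -
  note x = hmax_le[OF assms(1-4), folded x_def]
  have "1 / 2 * (1 / 2) \<le> x * x"
    using x(1) by (intro mult_mono) auto
  moreover have "(3 * real hmax + 5) * real hmax \<le> (25 * x) * (5 * x)"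
    using x by (intro mult_mono) auto
  ultimately have "2 + (3 * real hmax + 5) * real hmax \<le> 150 * x\<^sup>2"
    by (simp add: power2_eq_square)
  then have "total_mass G m * (2 + (3 * real hmax + 5) * real hmax) \<le> total_mass G m * (150 * x\<^sup>2)"
    using assms(4) by (intro mult_left_mono) auto
  then show "total_mass G m * (2 + (3 * real hmax + 5) * real hmax) \<le> 150 * (total_mass G m * x\<^sup>2)"
    by simp
  assume N: "1 \<le> N"
  have "1 * (1 / 2) \<le> real N * x"
    using x(1) N by (intro mult_mono) auto
  moreover have "(1 + 2 * real N) * real hmax \<le> (3 * real N) * (5 * x)"
    using x N by (intro mult_mono) auto
  ultimately have "2 + (1 + 2 * real N) * real hmax \<le> 150 * real N * x"
    by simp
  then have "total_mass G m * (2 + (1 + 2 * real N) * real hmax) \<le> total_mass G m * (150 * real N * x)"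
    using assms(4) by (intro mult_left_mono) auto
  then show "total_mass G m * (2 + (1 + 2 * real N) * real hmax) \<le> 150 * real N * (total_mass G m * x)"
    by (simp add: mult_ac)
qed

text \<open>A node with excess has degree at least one. The resulting strict bound makes the
  logarithm, and thus \<open>h\<close>, positive.\<close>

lemma excess_total_mass:
  assumes "valid s" "w \<in> pverts G" "deg w < mass s w"
  shows "1 < total_mass G m"
proof -
  have "0 < deg w"
    using assms valid_mass_le[OF assms(1,2)] by linarith
  then have "1 < mass s w"
    using assms(3) by simp
  also have "\<dots> \<le> (\<Sum>v\<in>pverts G. mass s v)"
    using assms valid_mass_nonneg[OF assms(1)] by (intro member_le_sum pair_finite_verts) auto
  finally show ?thesis
    by (simp add: total_mass_valid[OF assms(1)])
qed

lemma final_cut: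
  assumes params: "0 < \<phi>" "\<phi> \<le> 1" "C = 1 / \<phi>" "h = crd_height G m \<phi>"
    and total_le: "total_mass G m \<le> real (vol G (pverts G))"
    and final: "valid s" "crd_halted G h s" and w: "w \<in> pverts G" "deg w < mass s w"
  obtains A where "A \<subseteq> pverts G" "vol G A > 0" "vol G (pverts G - A) > 0"
    "total_mass G m \<ge> 2 \<Longrightarrow> conductance G A \<le> 150 * \<phi>"
    "\<forall>v\<in>A. deg v \<le> mass s v \<and> mass s v \<le> 2 * deg v" "\<forall>v\<in>pverts G - A. mass s v \<le> deg v"
proof -
  have "0 < h"
    using excess_total_mass[OF final(1) w] params by (simp add: crd_height_def)
  note final_facts = final w this total_le
  obtain i where i: "1 \<le> i" "i \<le> hmax"
    and sparse: "2 \<le> total_mass G m \<Longrightarrow>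
      C / 4 \<le> real i \<and> real (card (steps_at s i)) \<le> 8 * \<phi> * cut_vol s i"
  proof (cases "2 \<le> total_mass G m")
    case True
    then show ?thesis
      using exists_sparse_level[OF final_facts params] that by metis
  next
    \<comment> \<open>For total mass below \<open>2\<close> no conductance bound is claimed, and any
      level between \<open>1\<close> and \<open>hmax\<close> serves.\<close>
    case False
    then show ?thesis
      using hmax_pos[OF final_facts] that by blast
  qed
  have pos: "1 \<le> vol G (level s i)" "1 \<le> vol G (pverts G - level s i)"
    using final_vol_level[OF final_facts i(2)] final_vol_compl[OF final_facts i(1)] by auto
  then have "0 < cut_vol s i"
    by (simp add: cut_vol_def)
  then have "conductance G (level s i) \<le> 150 * \<phi>" if "2 \<le> total_mass G m"
    using conductance_level[OF final(1) params(1,3) i(1)] sparse[OF that] params(1)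
    by (smt (verit) mult_right_mono)
  then show ?thesis
    using that[of "level s i"] level_subset pos final_level_mass[OF final_facts i] by auto
qed

end

text \<open>Time is bounded at every length \<open>n\<close> of an implementation run, hence in
  particular when it halts. The bound linear in \<open>ln (total_mass G m) / \<phi>\<close> carries
  the granularity \<open>N\<close> as a factor; for arbitrary real masses the bound is quadratic in
  that quantity.\<close>

theorem theorem1:
  shows "\<exists>c::real. c > 0 \<and>
    (\<forall>(G :: 'a pair_pre_digraph) (m :: 'a \<Rightarrow> real) (\<phi> :: real) (h :: real) (C :: real).
       pair_graph G \<longrightarrow>
       (\<forall>v\<in>pverts G. 0 \<le> m v \<and> m v \<le> 2 * real (out_degree G v)) \<longrightarrow>
       0 < \<phi> \<longrightarrow> \<phi> \<le> 1 \<longrightarrow>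
       total_mass G m \<le> real (vol G (pverts G)) \<longrightarrow>
       h = crd_height G m \<phi> \<longrightarrow> C = 1 / \<phi> \<longrightarrow>
       \<not> (\<exists>\<sigma>. \<sigma> 0 = crd_init m \<and> (\<forall>i. crd_step G h C (\<sigma> i) (\<sigma> (Suc i)))) \<and>
       (\<forall>s. (crd_step G h C)\<^sup>*\<^sup>* (crd_init m) s \<and> crd_halted G h s \<longrightarrow>
          (\<forall>v\<in>pverts G. mass s v \<le> real (out_degree G v)) \<or>
          (\<exists>v\<in>pverts G. excess G s v > 0) \<and>
          (\<exists>A\<subseteq>pverts G. vol G A > 0 \<and> vol G (pverts G - A) > 0 \<and>
             (total_mass G m \<ge> 2 \<longrightarrow> conductance G A \<le> c * \<phi>) \<and>
             (\<forall>v\<in>A. real (out_degree G v) \<le> mass s v \<and> mass s v \<le> 2 * real (out_degree G v)) \<and>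
             (\<forall>v\<in>pverts G - A. mass s v \<le> real (out_degree G v)))) \<and>
       (\<forall>adj. adjacency_lists G adj \<longrightarrow>
          (\<forall>n s ptr. (crd_impl_step G h C adj ^^ n) (crd_impl_init m) (s, ptr) \<longrightarrow>
             (crd_step G h C)\<^sup>*\<^sup>* (crd_init m) s \<and>
             (total_mass G m \<ge> 2 \<longrightarrow>
                (\<forall>N. granular G m \<phi> N \<longrightarrow>
                   real (crd_time G h m n)
                     \<le> c * real N * (total_mass G m * ln (total_mass G m) / \<phi>)) \<and>
                real (crd_time G h m n)
                  \<le> c * (total_mass G m * (ln (total_mass G m) / \<phi>)\<^sup>2)))))"
proof (rule exI[of _ 150], intro conjI allI impI)
  fix G :: "'a pair_pre_digraph" and m :: "'a \<Rightarrow> real" and \<phi> h C :: real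
  assume G: "pair_graph G"
    and m: "\<forall>v\<in>pverts G. 0 \<le> m v \<and> m v \<le> 2 * real (out_degree G v)"
    and \<phi>: "0 < \<phi>" "\<phi> \<le> 1" and total: "total_mass G m \<le> real (vol G (pverts G))"
    and h: "h = crd_height G m \<phi>" and C: "C = 1 / \<phi>"
  interpret pair_graph G
    by (rule G)
  interpret crd_inner G m h C
    using m \<phi> C by unfold_locales auto
  show "\<not> (\<exists>\<sigma>. \<sigma> 0 = crd_init m \<and> (\<forall>i. crd_step G h C (\<sigma> i) (\<sigma> (Suc i))))"
    using no_infinite_run by blast
  {
    fix s assume s: "(crd_step G h C)\<^sup>*\<^sup>* (crd_init m) s \<and> crd_halted G h s"
    then have V: "valid s" "crd_halted G h s"
      using valid_steps valid_init by auto
    let ?cut = "\<lambda>A. vol G A > 0 \<and> vol G (pverts G - A) > 0 \<and>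
      (total_mass G m \<ge> 2 \<longrightarrow> conductance G A \<le> 150 * \<phi>) \<and>
      (\<forall>v\<in>A. real (out_degree G v) \<le> mass s v \<and> mass s v \<le> 2 * real (out_degree G v)) \<and>
      (\<forall>v\<in>pverts G - A. mass s v \<le> real (out_degree G v))"
    show "(\<forall>v\<in>pverts G. mass s v \<le> real (out_degree G v)) \<or>
      (\<exists>v\<in>pverts G. excess G s v > 0) \<and> (\<exists>A\<subseteq>pverts G. ?cut A)"
    proof (cases "\<forall>v\<in>pverts G. mass s v \<le> real (out_degree G v)")
      case False
      then obtain w where w: "w \<in> pverts G" "deg w < mass s w"
        by force
      then have "excess G s w > 0"
        by (simp add: excess_def)
      moreover from final_cut[OF \<phi> C h total V w] have "\<exists>A\<subseteq>pverts G. ?cut A"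
        by metis
      ultimately show ?thesis
        using w by blast
    qed simp
  }
  fix adj n s ptr
  assume adj: "adjacency_lists G adj"
    and run: "(crd_impl_step G h C adj ^^ n) (crd_impl_init m) (s, ptr)"
  show "(crd_step G h C)\<^sup>*\<^sup>* (crd_init m) s"
    using impl_run[OF adj run] by blast
  assume M: "total_mass G m \<ge> 2"
  note bounds = time_bounds[OF \<phi> h M]
  show "real (crd_time G h m n) \<le> 150 * (total_mass G m * (ln (total_mass G m) / \<phi>)\<^sup>2)"
    using impl_time[OF adj run] bounds(1) by linarith
  fix N assume "granular G m \<phi> N"
  then have N: "1 \<le> N" "real N * C \<in> \<int>" "\<forall>v\<in>pverts G. real N * m v \<in> \<int>"
    using C by (auto simp: granular_def)
  have "real (crd_time G h m n) \<le> 150 * real N * (total_mass G m * (ln (total_mass G m) / \<phi>))"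
    using impl_time_granular[OF adj run N] bounds(2)[OF N(1)] by linarith
  then show "real (crd_time G h m n) \<le> 150 * real N * (total_mass G m * ln (total_mass G m) / \<phi>)"
    by simp
qed simp

end
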